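(* Let $(\mathfrak g,\pi,\omega)$ be a Lie-Yamaguti algebra over a field $\mathbb K$ of characteristic $0$ (binary bracket $\pi$, ternary bracket $\omega$), and put $\Pi=(\pi,\omega)\in\mathfrak C^1(\mathfrak g,\mathfrak g)$. Then $(\mathfrak C^\bullet(\mathfrak g,\mathfrak g),[\cdot,\cdot]_{\mathsf{LieY}},d_\Pi)$ is a differential graded Lie algebra, where $d_\Pi:=[\Pi,\cdot]_{\mathsf{LieY}}$. If moreover $\Pi'\in\mathfrak C^1(\mathfrak g,\mathfrak g)$ is such that $\Pi+\Pi'$ defines a Lie-Yamaguti algebra structure on $\mathfrak g$, then $\Pi'$ is a Maurer-Cartan element of the differential graded Lie algebra $(\mathfrak C^\bullet(\mathfrak g,\mathfrak g),[\cdot,\cdot]_{\mathsf{LieY}},d_\Pi)$, i.e. $d_\Pi\Pi'+\tfrac12[\Pi',\Pi']_{\mathsf{LieY}}=0$.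
   Context: Lie-Yamaguti algebra: a vector space $\mathfrak g$ with a bilinear bracket $[\cdot,\cdot]:\wedge^2\mathfrak g\to\mathfrak g$ and a trilinear bracket $[\![\cdot,\cdot,\cdot]\!]:\wedge^2\mathfrak g\otimes\mathfrak g\to\mathfrak g$ such that for all $x,y,z,w,t\in\mathfrak g$: (1) $[[x,y],z]+[[y,z],x]+[[z,x],y]+[\![x,y,z]\!]+[\![y,z,x]\!]+[\![z,x,y]\!]=0$; (2) $[\![[x,y],z,w]\!]+[\![[y,z],x,w]\!]+[\![[z,x],y,w]\!]=0$; (3) $[\![x,y,[z,w]]\!]=[[\![x,y,z]\!],w]+[z,[\![x,y,w]\!]]$; (4) $[\![x,y,[\![z,w,t]\!]]\!]=[\![[\![x,y,z]\!],w,t]\!]+[\![z,[\![x,y,w]\!],t]\!]+[\![z,w,[\![x,y,t]\!]]\!]$. An element $(\pi,\omega)\in\mathfrak C^1(\mathfrak g,\mathfrak g)$ defines a Lie-Yamaguti structure if $[\cdot,\cdot]=\pi$, $[\![\cdot,\cdot,\cdot]\!]=\omega$ satisfy (1)-(4). Shuffles: $\mathbb S_{(i,n-i)}$ is the set of $\sigma\in S_n$ with $\sigma(1)<\cdots<\sigma(i)$ and $\sigma(i+1)<\cdots<\sigma(n)$ (only the identity if $i=0$ or $i=n$). The graded space: $\mathfrak C^0(\mathfrak g,\mathfrak g)=\mathrm{Hom}(\mathfrak g,\mathfrak g)$ and, for $p\ge1$, $\mathfrak C^p(\mathfrak g,\mathfrak g)=\mathrm{Hom}((\wedge^2\mathfrak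 g)^{\otimes p},\mathfrak g)\oplus\mathrm{Hom}((\wedge^2\mathfrak g)^{\otimes p}\otimes\mathfrak g,\mathfrak g)$, in degree $p$; elements are written $P=(P_{\rm I},P_{\rm II})$; $\mathfrak C^\bullet=\bigoplus_{p\ge0}\mathfrak C^p$. The operation $\circ$: below $\mathfrak X_i=x_i\wedge y_i\in\wedge^2\mathfrak g$ and $x\in\mathfrak g$. For $P\in\mathfrak C^p$, $Q\in\mathfrak C^q$ with $p,q\ge1$, $P\circ Q\in\mathfrak C^{p+q}$ is given by $$(P\circ Q)_{\rm I}(\mathfrak X_1,\dots,\mathfrak X_{p+q})=\sum_{\sigma\in\mathbb S_{(p,q)},\,\sigma(p+q)=p+q}(-1)^{pq}\mathrm{sign}(\sigma)P_{\rm II}(\mathfrak X_{\sigma(1)},\dots,\mathfrak X_{\sigma(p)},Q_{\rm I}(\mathfrak X_{\sigma(p+1)},\dots,\mathfrak X_{\sigma(p+q)}))$$ $$+\sum_{k=1}^p(-1)^{(k-1)q}\sum_{\sigma\in\mathbb S_{(k-1,q)}}\mathrm{sign}(\sigma)P_{\rm I}(\mathfrak X_{\sigma(1)},\dots,\mathfrak X_{\sigma(k-1)},x_{k+q}\wedge Q_{\rm II}(\mathfrak X_{\sigma(k)},\dots,\mathfrak X_{\sigma(k+q-1)},y_{k+q}),\mathfrak X_{k+q+1},\dots,\mathfrak X_{p+q})$$ $$+\sum_{k=1}^p(-1)^{(k-1)q}\sum_{\sigma\in\mathbb S_{(k-1,q)}}\mathrm{sign}(\sigma)P_{\rm I}(\mathfrak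 X_{\sigma(1)},\dots,\mathfrak X_{\sigma(k-1)},Q_{\rm II}(\mathfrak X_{\sigma(k)},\dots,\mathfrak X_{\sigma(k+q-1)},x_{k+q})\wedge y_{k+q},\mathfrak X_{k+q+1},\dots,\mathfrak X_{p+q}),$$ and $$(P\circ Q)_{\rm II}(\mathfrak X_1,\dots,\mathfrak X_{p+q},x)=\sum_{\sigma\in\mathbb S_{(p,q)}}(-1)^{pq}\mathrm{sign}(\sigma)P_{\rm II}(\mathfrak X_{\sigma(1)},\dots,\mathfrak X_{\sigma(p)},Q_{\rm II}(\mathfrak X_{\sigma(p+1)},\dots,\mathfrak X_{\sigma(p+q)},x))$$ $$+\sum_{k=1}^p(-1)^{(k-1)q}\sum_{\sigma\in\mathbb S_{(k-1,q)}}\mathrm{sign}(\sigma)P_{\rm II}(\mathfrak X_{\sigma(1)},\dots,\mathfrak X_{\sigma(k-1)},x_{k+q}\wedge Q_{\rm II}(\mathfrak X_{\sigma(k)},\dots,\mathfrak X_{\sigma(k+q-1)},y_{k+q}),\mathfrak X_{k+q+1},\dots,\mathfrak X_{p+q},x)$$ $$+\sum_{k=1}^p(-1)^{(k-1)q}\sum_{\sigma\in\mathbb S_{(k-1,q)}}\mathrm{sign}(\sigma)P_{\rm II}(\mathfrak X_{\sigma(1)},\dots,\mathfrak X_{\sigma(k-1)},Q_{\rm II}(\mathfrak X_{\sigma(k)},\dots,\mathfrak X_{\sigma(k+q-1)},x_{k+q})\wedge y_{k+q},\mathfrak X_{k+q+1},\dots,\mathfrak X_{p+q},x).$$ For $f,g\in\mathfrak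 C^0$ and $P\in\mathfrak C^p$ ($p\ge1$): $f\circ g$ is composition; $(f\circ P)_{\rm I}=f\circ P_{\rm I}$, $(f\circ P)_{\rm II}=f\circ P_{\rm II}$ (compositions); $(P\circ f)_{\rm I}(\mathfrak X_1,\dots,\mathfrak X_p)=\sum_{k=1}^pP_{\rm I}(\mathfrak X_1,\dots,\mathfrak X_{k-1},x_k\wedge f(y_k)+f(x_k)\wedge y_k,\mathfrak X_{k+1},\dots,\mathfrak X_p)$; $(P\circ f)_{\rm II}(\mathfrak X_1,\dots,\mathfrak X_p,x)=\sum_{k=1}^pP_{\rm II}(\mathfrak X_1,\dots,\mathfrak X_{k-1},x_k\wedge f(y_k)+f(x_k)\wedge y_k,\mathfrak X_{k+1},\dots,\mathfrak X_p,x)+P_{\rm II}(\mathfrak X_1,\dots,\mathfrak X_p,f(x))$. The bracket is $[P,Q]_{\mathsf{LieY}}=P\circ Q-(-1)^{pq}Q\circ P$ for $P\in\mathfrak C^p$, $Q\in\mathfrak C^q$. A Maurer-Cartan element of a differential graded Lie algebra $(L,[\cdot,\cdot],d)$ is a degree $1$ element $a$ with $da+\frac12[a,a]=0$. *)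

theory Defs
  imports
    Complex_Main
    "HOL-Library.Function_Algebras"
    "HOL-Library.Product_Plus"
    "HOL-Combinatorics.Permutations"
begin

section \<open>Lie-Yamaguti algebras\<close>

locale lie_yamaguti = vector_space scale
  for scale :: "'k::field_char_0 \<Rightarrow> 'g::ab_group_add \<Rightarrow> 'g" +
  fixes \<pi> :: "'g \<Rightarrow> 'g \<Rightarrow> 'g" and \<omega> :: "'g \<Rightarrow> 'g \<Rightarrow> 'g \<Rightarrow> 'g"
  assumes linear_pi: "Vector_Spaces.linear scale scale (\<lambda>x. \<pi> x y)"
      "Vector_Spaces.linear scale scale (\<lambda>y. \<pi> x y)"
    and alternating_pi: "\<pi> x x = 0"
    and linear_omega: "Vector_Spaces.linear scale scale (\<lambda>x. \<omega> x y z)"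
      "Vector_Spaces.linear scale scale (\<lambda>y. \<omega> x y z)"
      "Vector_Spaces.linear scale scale (\<lambda>z. \<omega> x y z)"
    and alternating_omega: "\<omega> x x z = 0"
    and LY1: "\<pi> (\<pi> x y) z + \<pi> (\<pi> y z) x + \<pi> (\<pi> z x) y + \<omega> x y z + \<omega> y z x + \<omega> z x y = 0"
    and LY2: "\<omega> (\<pi> x y) z w + \<omega> (\<pi> y z) x w + \<omega> (\<pi> z x) y w = 0"
    and LY3: "\<omega> x y (\<pi> z w) = \<pi> (\<omega> x y z) w + \<pi> z (\<omega> x y w)"
    and LY4: "\<omega> x y (\<omega> z w t) = \<omega> (\<omega> x y z) w t + \<omega> z (\<omega> x y w) t + \<omega> z w (\<omega> x y t)"


section \<open>Differential graded Lie algebras\<close>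

text \<open>
  The homogeneous components \<open>L p\<close> are subspaces of an ambient vector space and their sum
  is direct; the underlying space of the graded Lie algebra is that direct sum,
  \<open>span (\<Union>p. L p)\<close>. Components of negative degree are zero. The bracket and the differential
  are functions on the ambient space, constrained only on the direct sum. The ground field has
  characteristic 0, so these axioms need no supplement in characteristics 2 and 3.
\<close>

locale dg_lie_algebra = vector_space scale
  for scale :: "'k::field_char_0 \<Rightarrow> 'v::ab_group_add \<Rightarrow> 'v" +
  fixes L :: "nat \<Rightarrow> 'v set" and br :: "'v \<Rightarrow> 'v \<Rightarrow> 'v" and d :: "'v \<Rightarrow> 'v"
  assumes subspace_L: "subspace (L p)"
    and direct: "finite I \<Longrightarrow> (\<And>p. p \<in> I \<Longrightarrow> a p \<in> L p) \<Longrightarrow> (\<Sum>p\<in>I. a p) = 0 \<Longrightarrow>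
      p \<in> I \<Longrightarrow> a p = 0"
    and br_add_left: "x \<in> span (\<Union>p. L p) \<Longrightarrow> y \<in> span (\<Union>p. L p) \<Longrightarrow> z \<in> span (\<Union>p. L p) \<Longrightarrow>
      br (x + y) z = br x z + br y z"
    and br_add_right: "x \<in> span (\<Union>p. L p) \<Longrightarrow> y \<in> span (\<Union>p. L p) \<Longrightarrow> z \<in> span (\<Union>p. L p) \<Longrightarrow>
      br x (y + z) = br x y + br x z"
    and br_scale_left: "x \<in> span (\<Union>p. L p) \<Longrightarrow> y \<in> span (\<Union>p. L p) \<Longrightarrow>
      br (scale c x) y = scale c (br x y)"
    and br_scale_right: "x \<in> span (\<Union>p. L p) \<Longrightarrow> y \<in> span (\<Union>p. L p) \<Longrightarrow>
      br x (scale c y) = scale c (br x y)"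
    and br_degree: "x \<in> L p \<Longrightarrow> y \<in> L q \<Longrightarrow> br x y \<in> L (p + q)"
    and br_skew: "x \<in> L p \<Longrightarrow> y \<in> L q \<Longrightarrow> br x y = - scale ((-1) ^ (p * q)) (br y x)"
    and br_jacobi: "x \<in> L p \<Longrightarrow> y \<in> L q \<Longrightarrow> z \<in> L r \<Longrightarrow>
      br x (br y z) = br (br x y) z + scale ((-1) ^ (p * q)) (br y (br x z))"
    and d_add: "x \<in> span (\<Union>p. L p) \<Longrightarrow> y \<in> span (\<Union>p. L p) \<Longrightarrow> d (x + y) = d x + d y"
    and d_scale: "x \<in> span (\<Union>p. L p) \<Longrightarrow> d (scale c x) = scale c (d x)"
    and d_degree: "x \<in> L p \<Longrightarrow> d x \<in> L (p + 1)"
    and d_square: "x \<in> span (\<Union>p. L p) \<Longrightarrow> d (d x) = 0"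
    and d_leibniz: "x \<in> L p \<Longrightarrow> y \<in> L q \<Longrightarrow>
      d (br x y) = br (d x) y + scale ((-1) ^ p) (br x (d y))"

definition maurer_cartan ::
    "('k::field_char_0 \<Rightarrow> 'v::ab_group_add \<Rightarrow> 'v) \<Rightarrow> (nat \<Rightarrow> 'v set) \<Rightarrow> ('v \<Rightarrow> 'v \<Rightarrow> 'v) \<Rightarrow>
      ('v \<Rightarrow> 'v) \<Rightarrow> 'v \<Rightarrow> bool" where
  "maurer_cartan scale L br d a \<longleftrightarrow> a \<in> L 1 \<and> d a + scale (1 / 2) (br a a) = 0"


section \<open>Cochains\<close>

text \<open>
  A decomposable \<open>X = x \<and> y\<close> is represented by the pair \<open>(x, y)\<close>, and a linear map out of the
  \<open>p\<close>-fold tensor power of the exterior square of the vector space by a function on lists of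
  \<open>p\<close> pairs that is linear in each of the \<open>2 p\<close> vectors and vanishes if the two vectors of one
  pair agree (universal properties of tensor product and exterior square).

  A cochain \<open>P\<close> has components \<open>fst P = P_I\<close> and \<open>snd P = P_II\<close>. Homogeneous cochains of degree
  \<open>p\<close> are zero on lists of any length other than \<open>p\<close>. Hence a finite sum of cochains of different
  degrees is recovered from its restrictions to the lists of each length, and the ambient
  additive group of the type contains the direct sum of all \<open>cochains scale p\<close>.
\<close>

type_synonym 'g cochain = "(('g \<times> 'g) list \<Rightarrow> 'g) \<times> (('g \<times> 'g) list \<Rightarrow> 'g \<Rightarrow> 'g)"

definition cochain_scale :: "('k \<Rightarrow> 'g \<Rightarrow> 'g) \<Rightarrow> 'k \<Rightarrow> 'g cochain \<Rightarrow> 'g cochain" where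
  "cochain_scale scale c P = ((\<lambda>Xs. scale c (fst P Xs)), (\<lambda>Xs x. scale c (snd P Xs x)))"

definition wedge_multilinear ::
    "('k::field \<Rightarrow> 'g::ab_group_add \<Rightarrow> 'g) \<Rightarrow> nat \<Rightarrow> (('g \<times> 'g) list \<Rightarrow> 'g) \<Rightarrow> bool" where
  "wedge_multilinear scale p F \<longleftrightarrow>
    (\<forall>Xs. length Xs = p \<longrightarrow> (\<forall>i<p. 
      (\<forall>y. Vector_Spaces.linear scale scale (\<lambda>x. F (Xs[i := (x, y)]))) \<and>
      (\<forall>x. Vector_Spaces.linear scale scale (\<lambda>y. F (Xs[i := (x, y)]))) \<and>
      (\<forall>x. F (Xs[i := (x, x)]) = 0)))"

text \<open>In degree 0 there is only a second component, the linear map \<open>snd P []\<close>.\<close>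

definition cochains :: "('k::field \<Rightarrow> 'g::ab_group_add \<Rightarrow> 'g) \<Rightarrow> nat \<Rightarrow> 'g cochain set" where
  "cochains scale p = {P.
    (\<forall>Xs. length Xs \<noteq> p \<longrightarrow> fst P Xs = 0 \<and> (\<forall>x. snd P Xs x = 0)) \<and>
    (p = 0 \<longrightarrow> fst P [] = 0) \<and>
    wedge_multilinear scale p (fst P) \<and>
    (\<forall>x. wedge_multilinear scale p (\<lambda>Xs. snd P Xs x)) \<and>
    (\<forall>Xs. Vector_Spaces.linear scale scale (snd P Xs))}"

definition structure_cochain ::
    "('g::ab_group_add \<Rightarrow> 'g \<Rightarrow> 'g) \<Rightarrow> ('g \<Rightarrow> 'g \<Rightarrow> 'g \<Rightarrow> 'g) \<Rightarrow> 'g cochain" where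
  "structure_cochain \<pi> \<omega> =
    ((\<lambda>Xs. if length Xs = 1 then \<pi> (fst (hd Xs)) (snd (hd Xs)) else 0),
     (\<lambda>Xs z. if length Xs = 1 then \<omega> (fst (hd Xs)) (snd (hd Xs)) z else 0))"

definition defines_lie_yamaguti ::
    "('k::field_char_0 \<Rightarrow> 'g::ab_group_add \<Rightarrow> 'g) \<Rightarrow> 'g cochain \<Rightarrow> bool" where
  "defines_lie_yamaguti scale P \<longleftrightarrow> P \<in> cochains scale 1 \<and>
    lie_yamaguti scale (\<lambda>x y. fst P [(x, y)]) (\<lambda>x y z. snd P [(x, y)] z)"


section \<open>The bracket\<close>

text \<open>Positions in lists start at 0, so shuffles permute \<open>{0, \<dots>, n - 1}\<close>.\<close>

definition shuffles_on :: "nat \<Rightarrow> nat \<Rightarrow> (nat \<Rightarrow> nat) set" where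
  "shuffles_on i n = {\<sigma>. \<sigma> permutes {0..<n} \<and>
    strict_mono_on {0..<i} \<sigma> \<and> strict_mono_on {i..<n} \<sigma>}"

definition select :: "'a list \<Rightarrow> (nat \<Rightarrow> nat) \<Rightarrow> nat \<Rightarrow> nat \<Rightarrow> 'a list" where
  "select Xs \<sigma> a b = map (\<lambda>j. Xs ! \<sigma> j) [a..<b]"

text \<open>
  The last two sums of each component of \<open>P \<circ> Q\<close> for degrees \<open>p, q \<ge> 1\<close>, with \<open>F\<close> standing for
  \<open>P_I\<close>, respectively for \<open>P_II\<close> with fixed last argument, and \<open>G\<close> for \<open>Q_II\<close>. The index \<open>k\<close> here is
  \<open>k - 1\<close> in the customary numbering, with \<open>k\<close> running from 1 to \<open>p\<close>.
\<close>

definition insertion_sum ::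
    "('k::field \<Rightarrow> 'g::ab_group_add \<Rightarrow> 'g) \<Rightarrow> nat \<Rightarrow> nat \<Rightarrow> (('g \<times> 'g) list \<Rightarrow> 'g) \<Rightarrow>
      (('g \<times> 'g) list \<Rightarrow> 'g \<Rightarrow> 'g) \<Rightarrow> ('g \<times> 'g) list \<Rightarrow> 'g" where
  "insertion_sum scale p q F G Xs =
    (\<Sum>k<p. scale ((-1) ^ (k * q)) (\<Sum>\<sigma>\<in>shuffles_on k (k + q). scale (of_int (sign \<sigma>))
      (F (select Xs \<sigma> 0 k @
          (fst (Xs ! (k + q)), G (select Xs \<sigma> k (k + q)) (snd (Xs ! (k + q)))) #
          drop (k + q + 1) Xs)))) +
    (\<Sum>k<p. scale ((-1) ^ (k * q)) (\<Sum>\<sigma>\<in>shuffles_on k (k + q). scale (of_int (sign \<sigma>))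
      (F (select Xs \<sigma> 0 k @
          (G (select Xs \<sigma> k (k + q)) (fst (Xs ! (k + q))), snd (Xs ! (k + q))) #
          drop (k + q + 1) Xs))))"

text \<open>
  The sums in \<open>P \<circ> f\<close> for \<open>f\<close> of degree 0: the argument \<open>x\<^sub>k \<and> f y\<^sub>k + f x\<^sub>k \<and> y\<^sub>k\<close> is not
  decomposable, so multilinearity is used to split it.
\<close>

definition derivation_sum ::
    "nat \<Rightarrow> (('g \<times> 'g) list \<Rightarrow> 'g::ab_group_add) \<Rightarrow> ('g \<Rightarrow> 'g) \<Rightarrow> ('g \<times> 'g) list \<Rightarrow> 'g" where
  "derivation_sum p F f Xs =
    (\<Sum>k<p. F (Xs[k := (fst (Xs ! k), f (snd (Xs ! k)))]) +
           F (Xs[k := (f (fst (Xs ! k)), snd (Xs ! k))]))"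

text \<open>The components of \<open>P \<circ> Q\<close> for \<open>P\<close> of degree \<open>p\<close> and \<open>Q\<close> of degree \<open>q\<close>, on lists of length
  \<open>p + q\<close>.\<close>

definition circ_I ::
    "('k::field \<Rightarrow> 'g::ab_group_add \<Rightarrow> 'g) \<Rightarrow> nat \<Rightarrow> nat \<Rightarrow> 'g cochain \<Rightarrow> 'g cochain \<Rightarrow>
      ('g \<times> 'g) list \<Rightarrow> 'g" where
  "circ_I scale p q P Q Xs =
    (if p = 0 \<and> q = 0 then 0
     else if p = 0 then snd P [] (fst Q Xs)
     else if q = 0 then derivation_sum p (fst P) (snd Q []) Xs
     else
       (\<Sum>\<sigma> \<in> {\<sigma> \<in> shuffles_on p (p + q). \<sigma> (p + q - 1) = p + q - 1}.
          scale ((-1) ^ (p * q) * of_int (sign \<sigma>))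
            (snd P (select Xs \<sigma> 0 p) (fst Q (select Xs \<sigma> p (p + q)))))
       + insertion_sum scale p q (fst P) (snd Q) Xs)"

definition circ_II ::
    "('k::field \<Rightarrow> 'g::ab_group_add \<Rightarrow> 'g) \<Rightarrow> nat \<Rightarrow> nat \<Rightarrow> 'g cochain \<Rightarrow> 'g cochain \<Rightarrow>
      ('g \<times> 'g) list \<Rightarrow> 'g \<Rightarrow> 'g" where
  "circ_II scale p q P Q Xs x =
    (if p = 0 then snd P [] (snd Q Xs x)
     else if q = 0 then derivation_sum p (\<lambda>Ys. snd P Ys x) (snd Q []) Xs + snd P Xs (snd Q [] x)
     else
       (\<Sum>\<sigma> \<in> shuffles_on p (p + q).
          scale ((-1) ^ (p * q) * of_int (sign \<sigma>))
            (snd P (select Xs \<sigma> 0 p) (snd Q (select Xs \<sigma> p (p + q)) x)))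
       + insertion_sum scale p q (\<lambda>Ys. snd P Ys x) (snd Q) Xs)"

definition circ ::
    "('k::field \<Rightarrow> 'g::ab_group_add \<Rightarrow> 'g) \<Rightarrow> nat \<Rightarrow> nat \<Rightarrow> 'g cochain \<Rightarrow> 'g cochain \<Rightarrow> 'g cochain" where
  "circ scale p q P Q =
    ((\<lambda>Xs. if length Xs = p + q then circ_I scale p q P Q Xs else 0),
     (\<lambda>Xs x. if length Xs = p + q then circ_II scale p q P Q Xs x else 0))"

definition hom_bracket ::
    "('k::field \<Rightarrow> 'g::ab_group_add \<Rightarrow> 'g) \<Rightarrow> nat \<Rightarrow> nat \<Rightarrow> 'g cochain \<Rightarrow> 'g cochain \<Rightarrow> 'g cochain" where
  "hom_bracket scale p q P Q =
    circ scale p q P Q - cochain_scale scale ((-1) ^ (p * q)) (circ scale q p Q P)"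

text \<open>
  Extension of the bracket from homogeneous cochains to the direct sum. Since
  \<open>circ scale p q P Q\<close> only reads \<open>P\<close> on lists of length \<open>p\<close> and \<open>Q\<close> on lists of length \<open>q\<close>, the
  component of degree \<open>n\<close> of the bracket is the sum of \<open>hom_bracket scale p (n - p) P Q\<close>
  over \<open>p \<le> n\<close>; see \<open>bracket_homogeneous\<close> below.
\<close>

definition bracket ::
    "('k::field \<Rightarrow> 'g::ab_group_add \<Rightarrow> 'g) \<Rightarrow> 'g cochain \<Rightarrow> 'g cochain \<Rightarrow> 'g cochain" where
  "bracket scale P Q =
    ((\<lambda>Xs. \<Sum>p\<le>length Xs. fst (hom_bracket scale p (length Xs - p) P Q) Xs),
     (\<lambda>Xs x. \<Sum>p\<le>length Xs. snd (hom_bracket scale p (length Xs - p) P Q) Xs x))"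


section \<open>Consistency of the encoding\<close>

lemma structure_cochain_in_cochains:
  assumes "lie_yamaguti scale \<pi> \<omega>"
  shows "structure_cochain \<pi> \<omega> \<in> cochains scale 1"
proof -
  interpret lie_yamaguti scale \<pi> \<omega> by (fact assms)
  have 0: "Vector_Spaces.linear scale scale (\<lambda>x. 0)" by unfold_locales simp_all
  have "Vector_Spaces.linear scale scale (snd (structure_cochain \<pi> \<omega>) Xs)" for Xs
    by (cases "length Xs = 1") (simp_all add: structure_cochain_def linear_omega 0)
  then show ?thesis
    by (auto simp: cochains_def structure_cochain_def wedge_multilinear_def length_Suc_conv
        linear_pi linear_omega alternating_pi alternating_omega)
qed

lemma defines_lie_yamaguti_structure_cochain:
  assumes "lie_yamaguti scale \<pi> \<omega>"
  shows "defines_lie_yamaguti scale (structure_cochain \<pi> \<omega>)"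
  using structure_cochain_in_cochains[OF assms] assms
  by (simp add: defines_lie_yamaguti_def structure_cochain_def)

lemma cochains_zeroD:
  assumes "P \<in> cochains scale p" "length Xs \<noteq> p \<or> p = 0"
  shows "fst P Xs = 0"
  using assms by (cases "length Xs = p") (auto simp: cochains_def)

lemma cochains_zeroD2:
  assumes "P \<in> cochains scale p" "length Xs \<noteq> p"
  shows "snd P Xs x = 0"
  using assms by (auto simp: cochains_def)

lemma cochains_snd_zero:
  assumes "P \<in> cochains scale p"
  shows "snd P Xs 0 = 0"
proof -
  have "Vector_Spaces.linear scale scale (snd P Xs)"
    using assms by (simp add: cochains_def)
  then interpret Vector_Spaces.linear scale scale "snd P Xs" .
  show ?thesis by (rule zero)
qed

lemma wedge_multilinear_zero:
  assumes "wedge_multilinear scale p F" "length Xs = p" "i < p"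
  shows "F (Xs[i := (x, 0)]) = 0" "F (Xs[i := (0, x)]) = 0"
proof -
  have "Vector_Spaces.linear scale scale (\<lambda>y. F (Xs[i := (x, y)]))"
    using assms by (auto simp: wedge_multilinear_def)
  then interpret l: Vector_Spaces.linear scale scale "\<lambda>y. F (Xs[i := (x, y)])" .
  show "F (Xs[i := (x, 0)]) = 0" by (rule l.zero)
  have "Vector_Spaces.linear scale scale (\<lambda>y. F (Xs[i := (y, x)]))"
    using assms by (auto simp: wedge_multilinear_def)
  then interpret r: Vector_Spaces.linear scale scale "\<lambda>y. F (Xs[i := (y, x)])" .
  show "F (Xs[i := (0, x)]) = 0" by (rule r.zero)
qed

lemma wedge_multilinear_zero_append:
  assumes "wedge_multilinear scale p F" "length As + length Bs + 1 = p"
  shows "F (As @ (x, 0) # Bs) = 0" "F (As @ (0, x) # Bs) = 0"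
  using wedge_multilinear_zero[OF assms(1), of "As @ undefined # Bs" "length As" x] assms(2)
  by simp_all

lemma insertion_sum_other_degree:
  assumes "vector_space scale" "wedge_multilinear scale p F" "\<And>Ys. length Ys \<noteq> p \<Longrightarrow> F Ys = 0"
    "\<And>Ys x. length Ys \<noteq> q \<Longrightarrow> G Ys x = 0" "p' \<noteq> p \<or> q' \<noteq> q" "length Xs = p' + q'"
  shows "insertion_sum scale p' q' F G Xs = 0"
proof -
  interpret vector_space scale by fact
  have *: "F (select Xs \<sigma> 0 k @ (u, G (select Xs \<sigma> k (k + q')) v) # drop (k + q' + 1) Xs) = 0 \<and>
           F (select Xs \<sigma> 0 k @ (G (select Xs \<sigma> k (k + q')) v, u) # drop (k + q' + 1) Xs) = 0"
    if "k < p'" for \<sigma> k u v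
  proof (cases "p' = p")
    case True
    then have "G (select Xs \<sigma> k (k + q')) v = 0"
      using assms(4,5) by (simp add: select_def)
    then show ?thesis
      using wedge_multilinear_zero_append[OF assms(2), of "select Xs \<sigma> 0 k" "drop (k + q' + 1) Xs" u]
        True that assms(6) by (simp add: select_def)
  next
    case False
    then show ?thesis using that assms(6)
      by (intro conjI assms(3)) (simp_all add: select_def)
  qed
  show ?thesis
    unfolding insertion_sum_def using * by simp
qed

lemma derivation_sum_other_degree:
  assumes "wedge_multilinear scale p F" "\<And>Ys. length Ys \<noteq> p \<Longrightarrow> F Ys = 0"
    "p' \<noteq> p \<or> (\<forall>x. f x = 0)" "length Xs = p'"
  shows "derivation_sum p' F f Xs = 0"
proof (cases "p' = p")
  case True
  then show ?thesis
    using assms(3,4) wedge_multilinear_zero[OF assms(1)] by (simp add: derivation_sum_def)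
next
  case False
  then show ?thesis using assms(2,4) by (simp add: derivation_sum_def)
qed

lemma circ_other_degree:
  assumes "vector_space scale" "P \<in> cochains scale p" "Q \<in> cochains scale q" "p' \<noteq> p \<or> q' \<noteq> q"
  shows "circ scale p' q' P Q = 0"
proof -
  interpret vector_space scale by fact
  note z = cochains_zeroD[OF assms(2)] cochains_zeroD[OF assms(3)] cochains_zeroD2[OF assms(2)]
    cochains_zeroD2[OF assms(3)] cochains_snd_zero[OF assms(2)]
  have wP: "wedge_multilinear scale p (fst P)" "\<And>x. wedge_multilinear scale p (\<lambda>Xs. snd P Xs x)"
    using assms(2) by (auto simp: cochains_def)
  have comp: "snd P (select Xs \<sigma> 0 p') (fst Q (select Xs \<sigma> p' (p' + q'))) = 0"
       "snd P (select Xs \<sigma> 0 p') (snd Q (select Xs \<sigma> p' (p' + q')) x) = 0" for Xs \<sigma> x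
    using assms(4) z by (cases "p' = p"; simp add: select_def)+
  have ins: "insertion_sum scale p' q' (fst P) (snd Q) Xs = 0"
     "insertion_sum scale p' q' (\<lambda>Ys. snd P Ys x) (snd Q) Xs = 0" if "length Xs = p' + q'" for Xs x
    using insertion_sum_other_degree[OF assms(1) wP(1) _ _ assms(4) that, of "snd Q"]
      insertion_sum_other_degree[OF assms(1) wP(2) _ _ assms(4) that, of x "snd Q"] z by simp_all
  have der: "derivation_sum p' (fst P) (snd Q []) Xs = 0"
     "derivation_sum p' (\<lambda>Ys. snd P Ys x) (snd Q []) Xs = 0" if "length Xs = p'" "q' = 0" for Xs x
    using derivation_sum_other_degree[OF wP(1) _ _ that(1), of "snd Q []"]
      derivation_sum_other_degree[OF wP(2) _ _ that(1), of x "snd Q []"] z assms(4) that(2) by auto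
  have "circ_I scale p' q' P Q Xs = 0" if "length Xs = p' + q'" for Xs
    unfolding circ_I_def using comp(1) ins(1)[OF that] der(1)[of Xs] that z assms(4)
    by (cases "p' = p") auto
  moreover have "circ_II scale p' q' P Q Xs x = 0" if "length Xs = p' + q'" for Xs x
    unfolding circ_II_def using comp(2) ins(2)[OF that] der(2)[of Xs] that z assms(4)
    by (cases "p' = p") auto
  ultimately show ?thesis
    by (simp add: circ_def zero_prod_def zero_fun_def fun_eq_iff)
qed

lemma bracket_homogeneous:
  fixes scale :: "'k::field \<Rightarrow> 'g::ab_group_add \<Rightarrow> 'g"
  assumes "vector_space scale" "P \<in> cochains scale p" "Q \<in> cochains scale q"
  shows "bracket scale P Q = hom_bracket scale p q P Q"
proof -
  interpret vector_space scale by fact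
  have scale_0: "cochain_scale scale c 0 = 0" for c
    by (simp add: cochain_scale_def prod_eq_iff fun_eq_iff)
  have other: "hom_bracket scale p' q' P Q = 0" if "p' \<noteq> p \<or> q' \<noteq> q" for p' q'
  proof -
    have "circ scale q' p' Q P = 0"
      using circ_other_degree[OF assms(1,3,2), of q' p'] that by blast
    then show ?thesis
      using circ_other_degree[OF assms that] scale_0 by (simp add: hom_bracket_def)
  qed
  have len: "fst (hom_bracket scale p q P Q) Xs = 0 \<and> snd (hom_bracket scale p q P Q) Xs x = 0"
    if "length Xs \<noteq> p + q" for Xs x
    using that by (simp add: hom_bracket_def circ_def cochain_scale_def)
  have eq: "(\<Sum>i\<le>n. g (hom_bracket scale i (n - i) P Q)) = g (hom_bracket scale p q P Q)"
    if "g 0 = 0" "n \<noteq> p + q \<Longrightarrow> g (hom_bracket scale p q P Q) = 0" for n and g :: "'g cochain \<Rightarrow> 'g"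
  proof (cases "n = p + q")
    case True
    have "(\<Sum>i\<le>n. g (hom_bracket scale i (n - i) P Q)) =
        (\<Sum>i\<in>{p}. g (hom_bracket scale i (n - i) P Q))"
      using True other that(1) by (intro sum.mono_neutral_right) auto
    then show ?thesis using True by simp
  next
    case False
    have "g (hom_bracket scale i (n - i) P Q) = 0" if "i \<le> n" for i
      using False \<open>g 0 = 0\<close> other[of i "n - i"] that by (cases "i = p") auto
    then show ?thesis using False that(2) by simp
  qed
  have "fst (bracket scale P Q) Xs = fst (hom_bracket scale p q P Q) Xs" for Xs
    using eq[of "\<lambda>R. fst R Xs" "length Xs"] len by (simp add: bracket_def)
  moreover have "snd (bracket scale P Q) Xs x = snd (hom_bracket scale p q P Q) Xs x" for Xs x
    using eq[of "\<lambda>R. snd R Xs x" "length Xs"] len by (simp add: bracket_def)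
  ultimately show ?thesis by (simp add: prod_eq_iff fun_eq_iff)
qed

end

theory Submission
  imports Defs
begin

text \<open>
  Let \<open>i_X\<close> fix the first pair of a cochain to be \<open>X\<close>. In a shuffle the first pair goes to the
  front of the arguments of \<open>P\<close> or to the front of those of \<open>Q\<close>, hence, for \<open>Q\<close> of degree
  \<open>q > 0\<close>, \<open>i_X (P \<circ> Q) = (-1)^q (i_X P) \<circ> Q + P \<circ> (i_X Q)\<close>, whereas
  \<open>i_X (P \<circ> f) = (i_X P) \<circ> f + i_(f X) P\<close> for \<open>f\<close> of degree 0. By induction on the number of
  arguments these rules show that the associator \<open>(P \<circ> Q) \<circ> R - P \<circ> (Q \<circ> R)\<close> is graded symmetric
  in \<open>Q\<close> and \<open>R\<close>, without any further manipulation of shuffles. A commutator bracket of such a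
  graded pre-Lie product satisfies the graded Jacobi identity. Finally, \<open>[\<Pi>, \<Pi>] = 0\<close> amounts to the
  two derivation axioms (3) and (4) of a Lie-Yamaguti algebra; by the Jacobi identity it gives
  \<open>d\<^sub>\<Pi> \<circ> d\<^sub>\<Pi> = 0\<close>, and expanding \<open>[\<Pi> + \<Pi>', \<Pi> + \<Pi>'] = 0\<close> gives the Maurer-Cartan equation.
\<close>

section \<open>Signed insertions by recursion on the first argument\<close>

text \<open>The origin of the signs: \<open>sign \<sigma>\<close> refers to the order in which the
  pairs of \<open>F\<close> precede those of \<open>G\<close>. The factors
  \<open>(-1)^(p * q)\<close> and \<open>(-1)^(k * q)\<close> turn it into the sign for the block of
  \<open>G\<close> in front, so a pair taken by \<open>F\<close> costs one sign for every pair that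
  \<open>G\<close> still awaits. This is the \<open>sg (Suc q)\<close> of the recursions below. Each
  recursion step replaces \<open>F\<close> or \<open>G\<close> by a function of one pair less. The
  identities are therefore stated for functions on lists, additive in the slots that receive an
  insertion, and every induction generalises over these functions. They live in abelian groups with
  the sign operator \<open>sg\<close>; scalars enter with the shuffle sums and with multilinearity.
  The obstacle is the first component: the shuffles in the sum with \<open>Q_I\<close> in the last
  slot of \<open>P_II\<close> fix the last position, which a recursion on the first pair does not
  see. The last pair is cut off beforehand, and \<open>pair_ins_snoc\<close> relates the two ends of
  the list.\<close>

definition sg :: "nat \<Rightarrow> 'a::ab_group_add \<Rightarrow> 'a" where
  "sg n a = (if even n then a else - a)"

lemma sg_zero [simp]: "sg n 0 = 0"
  by (simp add: sg_def)

lemma sg_0 [simp]: "sg 0 a = a"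
  by (simp add: sg_def)

lemma sg_add: "sg n (a + b) = sg n a + sg n b"
  by (simp add: sg_def)

lemma sg_sg: "sg m (sg n a) = sg (m + n) a"
  by (simp add: sg_def)

lemma sg_sum: "sg n (\<Sum>i\<in>A. f i) = (\<Sum>i\<in>A. sg n (f i))"
  by (simp add: sg_def sum_negf)

text \<open>
  \<open>pair_ins q F G\<close> inserts \<open>G\<close>, which takes \<open>q\<close> pairs and a vector, into the vectors of the
  pairs that \<open>F\<close> takes; \<open>last_ins q F G\<close> inserts \<open>G\<close> into the last slot of \<open>F\<close>. The number \<open>p\<close> of
  pairs that go to \<open>F\<close> is determined by the length of the list, and the global signs
  \<open>(-1)^(p * q)\<close> and \<open>(-1)^(k * q)\<close> are such that no sign occurs when a pair goes to \<open>G\<close>.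
\<close>

fun pair_ins :: "nat \<Rightarrow> (('g \<times> 'g) list \<Rightarrow> 'b::ab_group_add) \<Rightarrow>
    (('g \<times> 'g) list \<Rightarrow> 'g \<Rightarrow> 'g::ab_group_add) \<Rightarrow>
    ('g \<times> 'g) list \<Rightarrow> 'b" where
  "pair_ins q F G [] = 0"
| "pair_ins 0 F G ((x, y) # Xs) =
    pair_ins 0 (\<lambda>Ys. F ((x, y) # Ys)) G Xs + F ((x, G [] y) # Xs) + F ((G [] x, y) # Xs)"
| "pair_ins (Suc q) F G (X # Xs) =
    sg (Suc q) (pair_ins (Suc q) (\<lambda>Ys. F (X # Ys)) G Xs) + pair_ins q F (\<lambda>Ys. G (X # Ys)) Xs"

fun last_ins :: "nat \<Rightarrow> (('g \<times> 'g) list \<Rightarrow> 'a \<Rightarrow> 'b::ab_group_add) \<Rightarrow> (('g \<times> 'g) list \<Rightarrow> 'a) \<Rightarrow>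
    ('g \<times> 'g) list \<Rightarrow> 'b" where
  "last_ins 0 F G Xs = F Xs (G [])"
| "last_ins (Suc q) F G [] = 0"
| "last_ins (Suc q) F G (X # Xs) =
    sg (Suc q) (last_ins (Suc q) (\<lambda>Ys. F (X # Ys)) G Xs) + last_ins q F (\<lambda>Ys. G (X # Ys)) Xs"

section \<open>Additivity of insertions and their dependence on list lengths\<close>

definition pair_additive :: "(('g::ab_group_add \<times> 'g) list \<Rightarrow> 'b::ab_group_add) \<Rightarrow> bool" where
  "pair_additive F \<longleftrightarrow>
    (\<forall>As Bs x. additive (\<lambda>y. F (As @ (x, y) # Bs)) \<and> additive (\<lambda>y. F (As @ (y, x) # Bs)))"

lemma pair_additive_Cons: "pair_additive F \<Longrightarrow> pair_additive (\<lambda>Ys. F (X # Ys))"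
  unfolding pair_additive_def
proof (intro allI)
  fix As Bs :: "('a \<times> 'a) list" and x
  assume "\<forall>As Bs x. additive (\<lambda>y. F (As @ (x, y) # Bs)) \<and> additive (\<lambda>y. F (As @ (y, x) # Bs))"
  from this[rule_format, of "X # As" x Bs]
  show "additive (\<lambda>y. F (X # As @ (x, y) # Bs)) \<and> additive (\<lambda>y. F (X # As @ (y, x) # Bs))"
    by simp
qed

lemma pair_additiveD:
  assumes "pair_additive F"
  shows "F ((x, y + y') # Xs) = F ((x, y) # Xs) + F ((x, y') # Xs)"
    "F ((y + y', x) # Xs) = F ((y, x) # Xs) + F ((y', x) # Xs)"
    "F ((x, 0) # Xs) = 0" "F ((0, x) # Xs) = 0"
    "F ((x, - y) # Xs) = - F ((x, y) # Xs)" "F ((- y, x) # Xs) = - F ((y, x) # Xs)"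
proof -
  have a: "additive (\<lambda>y. F ((x, y) # Xs))" "additive (\<lambda>y. F ((y, x) # Xs))"
    using assms[unfolded pair_additive_def, rule_format, of "[]"] by simp_all
  show "F ((x, y + y') # Xs) = F ((x, y) # Xs) + F ((x, y') # Xs)"
    "F ((y + y', x) # Xs) = F ((y, x) # Xs) + F ((y', x) # Xs)"
    "F ((x, 0) # Xs) = 0" "F ((0, x) # Xs) = 0"
    "F ((x, - y) # Xs) = - F ((x, y) # Xs)" "F ((- y, x) # Xs) = - F ((y, x) # Xs)"
    using a[THEN additive.add] a[THEN additive.zero] a[THEN additive.minus] by simp_all
qed

text \<open>\<open>G\<close> consumes \<open>q\<close> pairs and one further pair must receive its
  value, hence \<open>\<le>\<close> here and \<open><\<close> for \<open>last_ins\<close>. In the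
  inductions below these zeros remove the branches in which a pair goes to a factor that has no room
  for it.\<close>

lemma pair_ins_short: "length Xs \<le> q \<Longrightarrow> pair_ins q F G Xs = 0"
  by (induction q F G Xs rule: pair_ins.induct) simp_all

lemma last_ins_short: "length Xs < q \<Longrightarrow> last_ins q F G Xs = 0"
  by (induction q F G Xs rule: last_ins.induct) simp_all

lemma pair_ins_add: "pair_ins q (\<lambda>Ys. F Ys + F' Ys) G Xs = pair_ins q F G Xs + pair_ins q F' G Xs"
proof (induction Xs arbitrary: q F F' G)
  case (Cons X Xs)
  then show ?case by (cases X; cases q) (simp_all add: sg_add algebra_simps)
qed simp

lemma pair_ins_zero: "pair_ins q (\<lambda>Ys. 0) G Xs = 0"
  using pair_ins_add[of q "\<lambda>Ys. 0" "\<lambda>Ys. 0" G Xs] by simp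

lemma pair_ins_uminus: "pair_ins q (\<lambda>Ys. - F Ys) G Xs = - pair_ins q F G Xs"
  using pair_ins_add[of q F "\<lambda>Ys. - F Ys" G Xs] by (simp add: pair_ins_zero add_eq_0_iff)

lemma pair_ins_diff: "pair_ins q (\<lambda>Ys. F Ys - F' Ys) G Xs = pair_ins q F G Xs - pair_ins q F' G Xs"
  using pair_ins_add[of q F "\<lambda>Ys. - F' Ys" G Xs] by (simp add: pair_ins_uminus)

lemma pair_ins_sg: "pair_ins q (\<lambda>Ys. sg n (F Ys)) G Xs = sg n (pair_ins q F G Xs)"
  by (simp add: sg_def pair_ins_uminus)

lemma pair_ins_zero_right: "pair_additive F \<Longrightarrow> pair_ins q F (\<lambda>Ys x. 0) Xs = 0"
proof (induction Xs arbitrary: q F)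
  case (Cons X Xs)
  then show ?case
    by (cases X; cases q) (simp_all add: pair_additive_Cons pair_additiveD)
qed simp

lemma pair_ins_add_right:
  "pair_additive F \<Longrightarrow> pair_ins q F (\<lambda>Ys x. G Ys x + G' Ys x) Xs =
      pair_ins q F G Xs + pair_ins q F G' Xs"
proof (induction Xs arbitrary: q F G G')
  case (Cons X Xs)
  then show ?case
    by (cases X; cases q) (simp_all add: pair_additive_Cons pair_additiveD sg_add algebra_simps)
qed simp

lemma pair_ins_uminus_right: "pair_additive F \<Longrightarrow> pair_ins q F (\<lambda>Ys x. - G Ys x) Xs =
    - pair_ins q F G Xs"
  using pair_ins_add_right[of F q G "\<lambda>Ys x. - G Ys x" Xs]
      by (simp add: pair_ins_zero_right add_eq_0_iff)

lemma pair_ins_diff_right: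
  "pair_additive F \<Longrightarrow> pair_ins q F (\<lambda>Ys x. G Ys x - G' Ys x) Xs =
      pair_ins q F G Xs - pair_ins q F G' Xs"
  using pair_ins_add_right[of F q G "\<lambda>Ys x. - G' Ys x" Xs] by (simp add: pair_ins_uminus_right)

lemma pair_ins_cong_right:
  "(\<And>Ys x. length Ys = q \<Longrightarrow> G Ys x = G' Ys x) \<Longrightarrow> pair_ins q F G Xs = pair_ins q F G' Xs"
proof (induction Xs arbitrary: q F G G')
  case (Cons X Xs)
  show ?case
  proof (cases q)
    case 0
    have "pair_ins 0 (\<lambda>Ys. F (X # Ys)) G Xs = pair_ins 0 (\<lambda>Ys. F (X # Ys)) G' Xs"
      by (rule Cons.IH) (use Cons.prems 0 in auto)
    with 0 show ?thesis using Cons.prems by (cases X) simp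
  next
    case (Suc q')
    have "pair_ins q (\<lambda>Ys. F (X # Ys)) G Xs = pair_ins q (\<lambda>Ys. F (X # Ys)) G' Xs"
      by (rule Cons.IH) (use Cons.prems in auto)
    moreover have "pair_ins q' F (\<lambda>Ys. G (X # Ys)) Xs = pair_ins q' F (\<lambda>Ys. G' (X # Ys)) Xs"
      by (rule Cons.IH) (use Cons.prems Suc in auto)
    ultimately show ?thesis using Suc by simp
  qed
qed simp

text \<open>The recursion reads \<open>F\<close> only on lists of the length left over by
  \<open>G\<close>. With \<open>pair_ins_cong_right\<close> and the \<open>last_ins\<close> versions
  this removes the length tests of \<open>circ\<close> inside composites.\<close>

lemma pair_ins_cong_left:
  "length Xs = p + q \<Longrightarrow> (\<And>Ys. length Ys = p \<Longrightarrow> F Ys = F' Ys) \<Longrightarrow> pair_ins q F G Xs = pair_ins q F' G Xs"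
proof (induction Xs arbitrary: p q F F' G)
  case (Cons X Xs)
  show ?case
  proof (cases p)
    case 0
    then show ?thesis using Cons.prems by (simp add: pair_ins_short)
  next
    case (Suc p')
    have 1: "pair_ins q (\<lambda>Ys. F (X # Ys)) G Xs = pair_ins q (\<lambda>Ys. F' (X # Ys)) G Xs"
      by (rule Cons.IH[of p']) (use Cons.prems Suc in auto)
    show ?thesis
    proof (cases q)
      case 0
      then show ?thesis using 1 Cons.prems Suc by (cases X) simp
    next
      case (Suc q')
      have "pair_ins q' F (\<lambda>Ys. G (X # Ys)) Xs = pair_ins q' F' (\<lambda>Ys. G (X # Ys)) Xs"
        by (rule Cons.IH[of p]) (use Cons.prems Suc in auto)
      then show ?thesis using 1 Suc by simp
    qed
  qed
qed simp

lemma last_ins_add: "last_ins q (\<lambda>Ys x. F Ys x + F' Ys x) G Xs =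
    last_ins q F G Xs + last_ins q F' G Xs"
proof (induction Xs arbitrary: q F F' G)
  case Nil
  then show ?case by (cases q) simp_all
next
  case (Cons X Xs)
  then show ?case by (cases q) (simp_all add: sg_add algebra_simps)
qed

lemma last_ins_zero: "last_ins q (\<lambda>Ys x. 0) G Xs = 0"
  using last_ins_add[of q "\<lambda>Ys x. 0" "\<lambda>Ys x. 0" G Xs] by simp

lemma last_ins_uminus: "last_ins q (\<lambda>Ys x. - F Ys x) G Xs = - last_ins q F G Xs"
  using last_ins_add[of q F "\<lambda>Ys x. - F Ys x" G Xs] by (simp add: last_ins_zero add_eq_0_iff)

lemma last_ins_diff: "last_ins q (\<lambda>Ys x. F Ys x - F' Ys x) G Xs =
    last_ins q F G Xs - last_ins q F' G Xs"
  using last_ins_add[of q F "\<lambda>Ys x. - F' Ys x" G Xs] by (simp add: last_ins_uminus)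

lemma last_ins_sg: "last_ins q (\<lambda>Ys x. sg n (F Ys x)) G Xs = sg n (last_ins q F G Xs)"
  by (simp add: sg_def last_ins_uminus)

lemma last_ins_zero_right: "(\<And>Ys. additive (F Ys)) \<Longrightarrow> last_ins q F (\<lambda>Ys. 0) Xs = 0"
proof (induction Xs arbitrary: q F)
  case Nil
  then show ?case by (cases q) (simp_all add: additive.zero)
next
  case (Cons X Xs)
  then show ?case by (cases q) (simp_all add: additive.zero)
qed

lemma last_ins_add_right:
  "(\<And>Ys. additive (F Ys)) \<Longrightarrow> last_ins q F (\<lambda>Ys. G Ys + G' Ys) Xs =
      last_ins q F G Xs + last_ins q F G' Xs"
proof (induction Xs arbitrary: q F G G')
  case Nil
  then show ?case by (cases q) (simp_all add: additive.add)
next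
  case (Cons X Xs)
  then show ?case by (cases q) (simp_all add: additive.add sg_add algebra_simps)
qed

lemma last_ins_uminus_right:
  "(\<And>Ys. additive (F Ys)) \<Longrightarrow> last_ins q F (\<lambda>Ys. - G Ys) Xs = - last_ins q F G Xs"
  using last_ins_add_right[of F q G "\<lambda>Ys. - G Ys" Xs]
      by (simp add: last_ins_zero_right add_eq_0_iff)

lemma last_ins_diff_right:
  "(\<And>Ys. additive (F Ys)) \<Longrightarrow>
    last_ins q F (\<lambda>Ys. G Ys - G' Ys) Xs = last_ins q F G Xs - last_ins q F G' Xs"
  using last_ins_add_right[of F q G "\<lambda>Ys. - G' Ys" Xs] by (simp add: last_ins_uminus_right)

lemma last_ins_sg_right:
  "(\<And>Ys. additive (F Ys)) \<Longrightarrow> last_ins q F (\<lambda>Ys. sg n (G Ys)) Xs = sg n (last_ins q F G Xs)"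
  by (simp add: sg_def last_ins_uminus_right)

lemma last_ins_cong_right:
  "(\<And>Ys. length Ys = q \<Longrightarrow> G Ys = G' Ys) \<Longrightarrow> last_ins q F G Xs = last_ins q F G' Xs"
proof (induction Xs arbitrary: q F G G')
  case Nil
  then show ?case by (cases q) simp_all
next
  case (Cons X Xs)
  show ?case
  proof (cases q)
    case 0
    with Cons show ?thesis by simp
  next
    case (Suc q')
    have "last_ins q (\<lambda>Ys. F (X # Ys)) G Xs = last_ins q (\<lambda>Ys. F (X # Ys)) G' Xs"
      by (rule Cons.IH) (use Cons.prems in auto)
    moreover have "last_ins q' F (\<lambda>Ys. G (X # Ys)) Xs = last_ins q' F (\<lambda>Ys. G' (X # Ys)) Xs"
      by (rule Cons.IH) (use Cons.prems Suc in auto)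
    ultimately show ?thesis using Suc by simp
  qed
qed

lemma last_ins_cong_left:
  "length Xs = p + q \<Longrightarrow> (\<And>Ys. length Ys = p \<Longrightarrow> F Ys = F' Ys) \<Longrightarrow> last_ins q F G Xs = last_ins q F' G Xs"
proof (induction Xs arbitrary: p q F F' G)
  case (Cons X Xs)
  show ?case
  proof (cases q)
    case 0
    then show ?thesis using Cons.prems by simp
  next
    case (Suc q')
    have 1: "last_ins q (\<lambda>Ys. F (X # Ys)) G Xs = last_ins q (\<lambda>Ys. F' (X # Ys)) G Xs"
    proof (cases p)
      case 0
      then show ?thesis using Cons.prems by (simp add: last_ins_short)
    next
      case (Suc p')
      show ?thesis by (rule Cons.IH[of p']) (use Cons.prems Suc in auto)
    qed
    have "last_ins q' F (\<lambda>Ys. G (X # Ys)) Xs = last_ins q' F' (\<lambda>Ys. G (X # Ys)) Xs"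
      by (rule Cons.IH[of p]) (use Cons.prems Suc in auto)
    then show ?thesis using 1 Suc by simp
  qed
qed simp

section \<open>Composition of last-slot insertions\<close>

lemma last_ins_assoc:
  assumes "\<And>Ys. additive (F Ys)"
  shows "last_ins r (\<lambda>Ys x. last_ins q F (\<lambda>Zs. G Zs x) Ys) H Xs =
      last_ins (q + r) F (last_ins r G H) Xs"
  using assms
proof (induction Xs arbitrary: q r F G H)
  case Nil
  then show ?case by (cases r; cases q) simp_all
next
  case (Cons X Xs)
  note ad = Cons.prems
  note IH = Cons.IH[of "\<lambda>Ys. F (X # Ys)", OF ad] Cons.IH[of F, OF ad]
  show ?case
  proof (cases r)
    case 0
    show ?thesis
    proof (cases q)
      case (Suc q')
      then show ?thesis using 0 IH(1)[of 0 q G H] IH(2)[of 0 q' "\<lambda>Ys. G (X # Ys)" H]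
        by (simp add: last_ins_add last_ins_sg sg_add sg_sg)
    qed (simp add: 0)
  next
    case (Suc r')
    show ?thesis
    proof (cases q)
      case 0
      \<comment> \<open>With \<open>q = 0\<close> the inner insertion is evaluated on exactly
        \<open>r\<close> pairs, all of which \<open>H\<close> needs; the branch giving
        \<open>X\<close> to \<open>G\<close> vanishes by length.\<close>
      have "last_ins r' F (\<lambda>Ys. last_ins r G H (X # Ys)) Xs =
          last_ins r' F (\<lambda>Ys. last_ins r' G (\<lambda>Ys. H (X # Ys)) Ys) Xs"
        by (rule last_ins_cong_right) (simp add: Suc last_ins_short)
      then show ?thesis using Suc 0 IH(1)[of r 0 G H] IH(2)[of r' 0 G "\<lambda>Ys. H (X # Ys)"]
        by simp
    next
      case (Suc q')
      note s = Suc \<open>r = Suc r'\<close>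
      \<comment> \<open>No sign defect arises: on both sides a pair taken by \<open>F\<close> passes
        \<open>q + r\<close> awaited pairs, one taken by \<open>G\<close> passes \<open>r\<close>,
        and one taken by \<open>H\<close> passes none.\<close>
      have "last_ins (q' + r) F (\<lambda>Ys. last_ins r G H (X # Ys)) Xs
          = sg r (last_ins (q' + r) F (last_ins r (\<lambda>Ys. G (X # Ys)) H) Xs) + last_ins (q + r') F
              (last_ins r' G (\<lambda>Ys. H (X # Ys))) Xs"
      proof -
        have e: "(\<lambda>Ys. last_ins r G H (X # Ys)) =
            (\<lambda>Ys. sg r (last_ins r (\<lambda>Zs. G (X # Zs)) H Ys) + last_ins r' G (\<lambda>Zs. H (X # Zs)) Ys)"
          using s by simp
        have "q' + r = q + r'"
          using s by simp
        then show ?thesis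
          unfolding e by (simp add: last_ins_add_right last_ins_sg_right ad)
      qed
      then show ?thesis
        using s IH(1)[of r q G H] IH(2)[of r q' "\<lambda>Ys. G (X # Ys)" H]
            IH(2)[of r' q G "\<lambda>Ys. H (X # Ys)"]
        by (simp add: last_ins_add last_ins_sg sg_add sg_sg add_ac)
    qed
  qed
qed

section \<open>Associators of insertions\<close>

definition full_ins :: "nat \<Rightarrow> (('g \<times> 'g) list \<Rightarrow> 'g \<Rightarrow> 'b::ab_group_add) \<Rightarrow>
    (('g \<times> 'g) list \<Rightarrow> 'g \<Rightarrow> 'g::ab_group_add) \<Rightarrow> ('g \<times> 'g) list \<Rightarrow> 'g \<Rightarrow> 'b" where
  "full_ins q F G Xs x = last_ins q F (\<lambda>Ys. G Ys x) Xs + pair_ins q (\<lambda>Ys. F Ys x) G Xs"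

lemma full_ins_short: "length Xs < q \<Longrightarrow> full_ins q F G Xs x = 0"
  by (simp add: full_ins_def last_ins_short pair_ins_short)

lemma full_ins_Nil: "full_ins 0 F G [] x = F [] (G [] x)"
  by (simp add: full_ins_def)

lemma full_ins_0_Cons:
  "full_ins 0 F G ((x, y) # Xs) z =
    full_ins 0 (\<lambda>Ys. F ((x, y) # Ys)) G Xs z + F ((x, G [] y) # Xs) z + F ((G [] x, y) # Xs) z"
  by (simp add: full_ins_def)

lemma full_ins_Suc_Cons:
  "full_ins (Suc q) F G (X # Xs) x =
    sg (Suc q) (full_ins (Suc q) (\<lambda>Ys. F (X # Ys)) G Xs x) + full_ins q F (\<lambda>Ys. G (X # Ys)) Xs x"
  by (simp add: full_ins_def sg_add)

text \<open>\<open>H\<close> lands either in a pair of \<open>G\<close> or in a pair of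
  \<open>F\<close>. In the second case \<open>G\<close> and \<open>H\<close> are inserted
  independently, and exchanging their blocks of \<open>q\<close> and \<open>r\<close> pairs costs
  \<open>(-1)^(q * r)\<close>.\<close>

lemma pair_ins_last_ins:
  assumes "\<And>Ys. additive (F Ys)"
  shows "pair_ins r (last_ins q F G) H Xs = last_ins (q + r) F (pair_ins r G H) Xs +
    sg (q * r) (last_ins q (\<lambda>Ys x. pair_ins r (\<lambda>Zs. F Zs x) H Ys) G Xs)"
  using assms
proof (induction Xs arbitrary: q r F G H)
  case Nil
  then show ?case by (cases q; cases r) (simp_all add: additive.zero)
next
  case (Cons X Xs)
  note ad = Cons.prems
  note IH = Cons.IH[of "\<lambda>Ys. F (X # Ys)", OF ad] Cons.IH[of F, OF ad]
  obtain x y where X: "X = (x, y)" by fastforce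
  show ?case
  proof (cases q)
    case 0
    \<comment> \<open>Without pairs of its own \<open>G\<close> offers no place for
      \<open>H\<close>, so the first summand on the right must vanish.\<close>
    have "last_ins r F (pair_ins r G H) (X # Xs) = last_ins r F (\<lambda>Ys. 0) (X # Xs)"
      by (rule last_ins_cong_right) (simp add: pair_ins_short)
    with 0 show ?thesis
      by (simp add: last_ins_zero_right ad)
  next
    case (Suc q')
    note lin = pair_ins_add pair_ins_uminus pair_ins_diff last_ins_add last_ins_uminus last_ins_diff
      last_ins_diff_right
      last_ins_add_right last_ins_uminus_right ad
    show ?thesis
    proof (cases r)
      case 0
      note IH' = IH(1)[of 0 q G H, unfolded 0 Suc X]
          IH(2)[of 0 q' "\<lambda>Ys. G (X # Ys)" H, unfolded 0 Suc X]
      show ?thesis unfolding 0 Suc X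
        by (cases "even q'") (simp_all add: sg_def lin IH' algebra_simps)
    next
      case (Suc r')
      note qr = \<open>q = Suc q'\<close> Suc
      note IH' = IH(1)[of r q G H, unfolded qr] IH(2)[of r q' "\<lambda>Ys. G (X # Ys)" H, unfolded qr]
        IH(2)[of r' q G "\<lambda>Ys. H (X # Ys)", unfolded qr]
      show ?thesis unfolding qr
        by (cases "even q'"; cases "even r'") (simp_all add: sg_def lin IH' algebra_simps)
    qed
  qed
qed

text \<open>\<open>H\<close> is inserted either into an argument of \<open>G\<close>, which gives
  the first summand, or into a vector of \<open>F\<close> not occupied by \<open>G\<close>, possibly
  the other half of the same pair. The latter double insertions are symmetric up to
  \<open>(-1)^(q * r)\<close>; they equal the composite in the opposite order without the terms
  where \<open>G\<close> lands inside \<open>H\<close>.\<close>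

lemma pair_ins_pair_ins:
  assumes "pair_additive F"
  shows "pair_ins r (pair_ins q F G) H Xs = pair_ins (q + r) F (full_ins r G H) Xs +
    sg (q * r) (pair_ins q (pair_ins r F H) G Xs - pair_ins (r + q) F (full_ins q H G) Xs)"
  using assms
proof (induction Xs arbitrary: q r F G H)
  case Nil
  then show ?case by simp
next
  case (Cons X Xs)
  note ad = Cons.prems pair_additive_Cons[OF Cons.prems]
  note IH = Cons.IH[of "\<lambda>Ys. F (X # Ys)", OF ad(2)] Cons.IH[OF ad(1)]
  obtain x y where X: "X = (x, y)" by fastforce
  note lin = pair_ins_add pair_ins_uminus pair_ins_diff pair_ins_diff_right pair_ins_add_right
      pair_ins_uminus_right
    pair_additiveD pair_additive_Cons ad
  \<comment> \<open>If one of the two degrees is 0, the sign is 1 and the identity is invariant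
    under exchanging \<open>G\<close> and \<open>H\<close>, after moving terms across. One
    computation thus serves both mixed cases.\<close>
  have left_0: "pair_ins (Suc r) (pair_ins 0 F G) H (X # Xs) =
      pair_ins (Suc r) F (full_ins (Suc r) G H) (X # Xs) +
    (pair_ins 0 (pair_ins (Suc r) F H) G (X # Xs) - pair_ins (Suc r) F (full_ins 0 H G) (X # Xs))" for r G H
  proof -
    \<comment> \<open>If \<open>X\<close> went to \<open>G\<close>, only \<open>r\<close> pairs
      would remain for \<open>H\<close>, which awaits \<open>Suc r\<close>.\<close>
    have e: "pair_ins r F (\<lambda>Ys. full_ins (Suc r) G H (X # Ys)) Xs =
        pair_ins r F (full_ins r G (\<lambda>Ys. H (X # Ys))) Xs"
      by (rule pair_ins_cong_right) (simp add: full_ins_Suc_Cons full_ins_short)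
    \<comment> \<open>A \<open>G\<close> of degree 0 also acts on the fixed pair itself; the last
      two terms are this action.\<close>
    have e2: "(\<lambda>Ys. full_ins 0 H G (X # Ys)) = (\<lambda>Ys z. full_ins 0 (\<lambda>Ys. H (X # Ys)) G Ys z +
      (H ((x, G [] y) # Ys) z + H ((G [] x, y) # Ys) z))"
      by (simp add: X full_ins_0_Cons fun_eq_iff add_ac)
    note IH' = IH(1)[of "Suc r" 0 G H, unfolded X] IH(2)[of r 0 G "\<lambda>Ys. H (X # Ys)", unfolded X]
    show ?thesis
      unfolding X
      by (cases "even r") (simp_all add: sg_def lin IH' e[unfolded X] e2[unfolded X] algebra_simps)
  qed
  show ?case
  proof (cases q)
    case q: 0
    show ?thesis
    proof (cases r)
      case 0
      show ?thesis unfolding q 0 X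
        by (simp add: lin algebra_simps full_ins_Nil IH(1)[of 0 0 G H, unfolded X])
    next
      case (Suc r')
      then show ?thesis using q left_0[of r' G H] by simp
    qed
  next
    case q: (Suc q')
    show ?thesis
    proof (cases r)
      case 0
      then show ?thesis using q left_0[of q' H G] by (simp add: algebra_simps)
    next
      case (Suc r')
      have e: "(\<lambda>Ys. full_ins (Suc a) G H (X # Ys)) =
          (\<lambda>Ys z. sg (Suc a) (full_ins (Suc a) (\<lambda>Ys. G (X # Ys)) H Ys z) +
        full_ins a G (\<lambda>Ys. H (X # Ys)) Ys z)" for a G H
        by (simp add: full_ins_Suc_Cons fun_eq_iff)
      note IH' = IH(1)[of r q G H, unfolded q Suc]
          IH(2)[of r q' "\<lambda>Ys. G (X # Ys)" H, unfolded q Suc]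
        IH(2)[of r' q G "\<lambda>Ys. H (X # Ys)", unfolded q Suc]
      show ?thesis unfolding q Suc
        by (cases "even q'"; cases "even r'") (simp_all add: sg_def lin e IH' algebra_simps)
    qed
  qed
qed

lemma last_ins_full_ins:
  assumes "\<And>Ys. additive (F Ys)"
  shows "last_ins r (full_ins q F G) K Xs = last_ins (q + r) F (last_ins r G K) Xs +
    last_ins r (\<lambda>Ys x. pair_ins q (\<lambda>Zs. F Zs x) G Ys) K Xs"
  unfolding full_ins_def[abs_def] last_ins_add by (simp only: last_ins_assoc[OF assms])

lemma full_ins_full_ins:
  assumes "\<And>Ys. additive (F Ys)" "pair_additive (\<lambda>Ys. F Ys x)"
  shows "full_ins r (full_ins q F G) H Xs x = full_ins (q + r) F (full_ins r G H) Xs x +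
    sg (q * r) (full_ins q (full_ins r F H) G Xs x - full_ins (r + q) F (full_ins q H G) Xs x)"
proof -
  \<comment> \<open>The second and fourth summands have one function in the last slot of
    \<open>F\<close> and the other in a pair of \<open>F\<close>. Exchanging the two functions swaps
    these summands up to \<open>(-1)^(a * b)\<close>, so they drop out of the comparison. The first
    and third summands also occur in \<open>compose\<close>.\<close>
  have expand: "full_ins b (full_ins a F K) J Xs x =
      last_ins (a + b) F (last_ins b K (\<lambda>Ys. J Ys x)) Xs +
      last_ins b (\<lambda>Ys u. pair_ins a (\<lambda>Zs. F Zs u) K Ys) (\<lambda>Ys. J Ys x) Xs +
      last_ins (a + b) F (pair_ins b (\<lambda>Ys. K Ys x) J) Xs +
      sg (a * b) (last_ins a (\<lambda>Ys u. pair_ins b (\<lambda>Zs. F Zs u) J Ys) (\<lambda>Ys. K Ys x) Xs) +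
      pair_ins b (pair_ins a (\<lambda>Ys. F Ys x) K) J Xs" for a b K J
  proof -
    have "pair_ins b (\<lambda>Ys. full_ins a F K Ys x) J Xs =
        pair_ins b (last_ins a F (\<lambda>Ys. K Ys x)) J Xs + pair_ins b (pair_ins a (\<lambda>Ys. F Ys x) K) J Xs"
      unfolding full_ins_def pair_ins_add ..
    then show ?thesis
      unfolding full_ins_def[of b "full_ins a F K"] last_ins_full_ins[OF assms(1)]
      by (simp add: pair_ins_last_ins[OF assms(1)])
  qed
  have compose: "full_ins (a + b) F (full_ins b K J) Xs x =
      last_ins (a + b) F (last_ins b K (\<lambda>Ys. J Ys x)) Xs +
      last_ins (a + b) F (pair_ins b (\<lambda>Ys. K Ys x) J) Xs + pair_ins (a + b) (\<lambda>Ys. F Ys x)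
          (full_ins b K J) Xs" for a b K J
  proof -
    have "last_ins (a + b) F (\<lambda>Ys. full_ins b K J Ys x) Xs =
        last_ins (a + b) F (last_ins b K (\<lambda>Ys. J Ys x)) Xs +
      last_ins (a + b) F (pair_ins b (\<lambda>Ys. K Ys x) J) Xs"
      unfolding full_ins_def by (rule last_ins_add_right[OF assms(1)])
    then show ?thesis
      unfolding full_ins_def[of "a + b" F] by simp
  qed
  show ?thesis
    unfolding expand compose
    using pair_ins_pair_ins[OF assms(2), of r q G H Xs]
    by (cases "even q"; cases "even r"; simp add: sg_def)
qed

text \<open>
  The first sum of the first component of \<open>P \<circ> Q\<close>: the shuffles fix the last position, so the
  last pair always is the last argument of \<open>G\<close>.
\<close>

definition snoc_ins :: "nat \<Rightarrow> nat \<Rightarrow> (('g \<times> 'g) list \<Rightarrow> 'a \<Rightarrow> 'b::ab_group_add) \<Rightarrow>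
    (('g \<times> 'g) list \<Rightarrow> 'a) \<Rightarrow> ('g \<times> 'g) list \<Rightarrow> 'b" where
  "snoc_ins p q F G Xs =
    (if q = 0 \<or> Xs = [] then 0
     else sg p (last_ins (q - 1) F (\<lambda>Ys. G (Ys @ [last Xs])) (butlast Xs)))"

lemma snoc_ins_Nil [simp]: "snoc_ins p q F G [] = 0"
  by (simp add: snoc_ins_def)

lemma snoc_ins_0 [simp]: "snoc_ins p 0 F G Xs = 0"
  by (simp add: snoc_ins_def)

lemma snoc_ins_snoc:
  "q > 0 \<Longrightarrow> snoc_ins p q F G (Xs @ [X]) = sg p (last_ins (q - 1) F (\<lambda>Ys. G (Ys @ [X])) Xs)"
  by (simp add: snoc_ins_def)

lemma snoc_ins_cong_left:
  assumes "length Xs = p + q" "\<And>Ys. length Ys = p \<Longrightarrow> F Ys = F' Ys"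
  shows "snoc_ins p q F G Xs = snoc_ins p q F' G Xs"
  unfolding snoc_ins_def
  using last_ins_cong_left[of "butlast Xs" p "q - 1" F F'] assms by auto

lemma snoc_ins_cong_right:
  assumes "\<And>Ys. length Ys = q \<Longrightarrow> G Ys = G' Ys"
  shows "snoc_ins p q F G Xs = snoc_ins p q F G' Xs"
proof -
  have "last_ins (q - 1) F (\<lambda>Ys. G (Ys @ [X])) Ys = last_ins (q - 1) F (\<lambda>Ys. G' (Ys @ [X])) Ys"
      if "q > 0" for X Ys
    by (rule last_ins_cong_right) (use assms that in auto)
  then show ?thesis by (simp add: snoc_ins_def)
qed

lemma snoc_ins_add:
  "snoc_ins p q (\<lambda>Ys x. F Ys x + F' Ys x) G Xs = snoc_ins p q F G Xs + snoc_ins p q F' G Xs"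
  by (simp add: snoc_ins_def last_ins_add sg_add)

lemma snoc_ins_add_right:
  "(\<And>Ys. additive (F Ys)) \<Longrightarrow>
    snoc_ins p q F (\<lambda>Ys. G Ys + G' Ys) Xs = snoc_ins p q F G Xs + snoc_ins p q F G' Xs"
  by (simp add: snoc_ins_def last_ins_add_right sg_add)

text \<open>If the last pair receives the value of \<open>G\<close>, all pairs of \<open>G\<close>
  come from \<open>Xs\<close>, and the insertion becomes a last-slot insertion into \<open>F\<close>
  with the other vector of that pair frozen. \<open>G\<close> cannot take the last pair, since a
  later pair would have to receive its value.\<close>

lemma pair_ins_snoc:
  "pair_ins q F G (Xs @ [(x, y)]) = pair_ins q (\<lambda>Ys. F (Ys @ [(x, y)])) G Xs +
    last_ins q (\<lambda>Ys u. F (Ys @ [(x, u)])) (\<lambda>Ys. G Ys y) Xs +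
    last_ins q (\<lambda>Ys u. F (Ys @ [(u, y)])) (\<lambda>Ys. G Ys x) Xs"
proof (induction Xs arbitrary: q F G)
  case Nil
  then show ?case by (cases q) simp_all
next
  case (Cons X Xs)
  then show ?case by (cases X; cases q) (simp_all add: sg_add algebra_simps)
qed

text \<open>\<open>H\<close> lands in a pair of \<open>G\<close>, the last pair included, or in a
  pair of \<open>F\<close>. The insertions into pairs of \<open>F\<close> are written as
  \<open>full_ins r F H\<close> minus the terms where \<open>H\<close> sits in the last slot of
  \<open>F\<close> and encloses the value of \<open>G\<close>. This transfers terms between
  \<open>(P \<circ> Q) \<circ> R\<close> and \<open>(P \<circ> R) \<circ> Q\<close> in the first
  component.\<close>

lemma pair_ins_snoc_ins:
  assumes "\<And>Ys. additive (F Ys)"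
  shows "pair_ins r (snoc_ins p q F G) H Xs = snoc_ins p (q + r) F (pair_ins r G H) Xs +
    sg (q * r) (snoc_ins (p + r) q (full_ins r F H) G Xs - snoc_ins p (r + q) F (snoc_ins r q H G) Xs)"
proof (cases "q = 0 \<or> Xs = []")
  case True
  \<comment> \<open>For \<open>q = 0\<close> the function \<open>pair_ins r G H\<close> is read on
    \<open>r\<close> pairs only, where it vanishes because no pair is left to receive
    \<open>H\<close>.\<close>
  have "snoc_ins p r F (pair_ins r G H) Xs = snoc_ins p r F (\<lambda>Ys. 0) Xs"
    by (rule snoc_ins_cong_right) (simp add: pair_ins_short)
  moreover have "snoc_ins p r F (\<lambda>Ys. 0) Xs = 0"
    using assms by (simp add: snoc_ins_def last_ins_zero_right)
  moreover have "snoc_ins r 0 H G = (\<lambda>Ys. 0)" "snoc_ins p 0 F G = (\<lambda>Ys. 0)"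
    by auto
  ultimately show ?thesis using True by (auto simp: pair_ins_zero)
next
  case False
  then obtain q' Ys x y where q: "q = Suc q'" and Xs: "Xs = Ys @ [(x, y)]"
    by (metis not0_implies_Suc rev_exhaust surj_pair)
  have p_lt: "q + r > 0" "r + q > 0" "q > 0" using q by auto
  have assoc: "last_ins r (\<lambda>Zs u. last_ins q' F (\<lambda>Ws. K Ws u) Zs) J Ys =
      last_ins (q' + r) F (last_ins r K J) Ys"
    for K :: "('a \<times> 'a) list \<Rightarrow> 'a \<Rightarrow> 'a" and J
    by (rule last_ins_assoc[OF assms])
  have full: "last_ins q' (full_ins r F H) G' Ys = last_ins (r + q') F (last_ins q' H G') Ys +
    last_ins q' (\<lambda>Zs x. pair_ins r (\<lambda>Ws. F Ws x) H Zs) G' Ys" for G'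
    unfolding full_ins_def
        using last_ins_assoc[OF assms, where r = q' and q = r and G = H and H = G' and Xs = Ys]
            by (simp add: last_ins_add)
  have "pair_ins r (snoc_ins p q F G) H Xs =
      sg p (last_ins (q' + r) F (pair_ins r (\<lambda>Zs. G (Zs @ [(x, y)])) H) Ys +
     sg (q' * r) (last_ins q' (\<lambda>Zs x. pair_ins r (\<lambda>Ws. F Ws x) H Zs) (\<lambda>Zs. G (Zs @ [(x, y)])) Ys)
     + last_ins (q' + r) F (last_ins r (\<lambda>Ws u. G (Ws @ [(x, u)])) (\<lambda>Zs. H Zs y)) Ys
     + last_ins (q' + r) F (last_ins r (\<lambda>Ws u. G (Ws @ [(u, y)])) (\<lambda>Zs. H Zs x)) Ys)"
    unfolding Xs pair_ins_snoc snoc_ins_snoc[OF p_lt(3)] pair_ins_sg last_ins_sg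
    by (simp add: q pair_ins_last_ins[OF assms] assoc sg_add)
  moreover have "snoc_ins p (q + r) F (pair_ins r G H) Xs =
      sg p (last_ins (q' + r) F (pair_ins r (\<lambda>Zs. G (Zs @ [(x, y)])) H) Ys
     + last_ins (q' + r) F (last_ins r (\<lambda>Ws u. G (Ws @ [(x, u)])) (\<lambda>Zs. H Zs y)) Ys
     + last_ins (q' + r) F (last_ins r (\<lambda>Ws u. G (Ws @ [(u, y)])) (\<lambda>Zs. H Zs x)) Ys)"
    unfolding Xs snoc_ins_snoc[OF p_lt(1)] pair_ins_snoc by (simp add: q last_ins_add_right assms)
  moreover have "snoc_ins (p + r) q (full_ins r F H) G Xs =
      sg (p + r) (last_ins (r + q') F (last_ins q' H (\<lambda>Zs. G (Zs @ [(x, y)]))) Ys +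
    last_ins q' (\<lambda>Zs x. pair_ins r (\<lambda>Ws. F Ws x) H Zs) (\<lambda>Zs. G (Zs @ [(x, y)])) Ys)"
    unfolding Xs snoc_ins_snoc[OF p_lt(3)] by (simp add: q full)
  moreover have "snoc_ins p (r + q) F (snoc_ins r q H G) Xs =
      sg (p + r) (last_ins (r + q') F (last_ins q' H (\<lambda>Zs. G (Zs @ [(x, y)]))) Ys)"
    unfolding Xs snoc_ins_snoc[OF p_lt(2)] snoc_ins_snoc[OF p_lt(3)]
        by (simp add: q last_ins_sg_right assms sg_sg)
  ultimately show ?thesis
    by (cases "even p"; cases "even q"; cases "even r"; simp add: sg_def q)
qed

section \<open>Shuffle sums\<close>

text \<open>
  A shuffle of \<open>n + 1\<close> positions has the value 0 at the start of one of its two blocks: in the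
  first case it is a lifted shuffle, in the second a lifted shuffle after a cycle of sign
  \<open>(-1)^(k + 1)\<close>.
\<close>

definition lift_perm :: "(nat \<Rightarrow> nat) \<Rightarrow> nat \<Rightarrow> nat" where
  "lift_perm \<sigma> i = (case i of 0 \<Rightarrow> 0 | Suc j \<Rightarrow> Suc (\<sigma> j))"

definition rotation :: "nat \<Rightarrow> nat \<Rightarrow> nat" where
  "rotation k i = (if i = k then 0 else if i < k then Suc i else i)"

lemma lift_perm_simps [simp]: "lift_perm \<sigma> 0 = 0" "lift_perm \<sigma> (Suc i) = Suc (\<sigma> i)"
  by (simp_all add: lift_perm_def)

lemma inj_lift_perm: "inj lift_perm"
proof (rule injI)
  fix \<sigma> \<tau> assume "lift_perm \<sigma> = lift_perm \<tau>"
  then have "lift_perm \<sigma> (Suc i) = lift_perm \<tau> (Suc i)" for i by simp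
  then show "\<sigma> = \<tau>" by (auto simp: fun_eq_iff)
qed

text \<open>\<open>lift_perm \<sigma>\<close> is the transport of \<open>\<sigma>\<close> along the
  injection \<open>Suc\<close>, which preserves the sign.\<close>

lemma lift_perm_permutes:
  assumes "\<sigma> permutes {0..<n}"
  shows "lift_perm \<sigma> permutes {0..<Suc n}" "sign (lift_perm \<sigma>) = sign \<sigma>"
proof -
  have "map_permutation {0..<n} Suc \<sigma> i = lift_perm \<sigma> i" for i
  proof (cases i)
    case (Suc j)
    then show ?thesis
      using permutes_not_in[OF assms, of j]
      by (auto simp: map_permutation_def restrict_id_def inv_into_f_f image_iff)
  qed (auto simp: map_permutation_def restrict_id_def)
  then have eq: "map_permutation {0..<n} Suc \<sigma> = lift_perm \<sigma>" by blast
  have "map_permutation {0..<n} Suc \<sigma> permutes {Suc 0..<Suc n}"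
    by (rule map_permutation_permutes) (use assms in \<open>auto simp: bij_betw_def\<close>)
  then show "lift_perm \<sigma> permutes {0..<Suc n}"
    unfolding eq by (rule permutes_subset) auto
  show "sign (lift_perm \<sigma>) = sign \<sigma>"
    unfolding eq[symmetric] by (rule sign_map_permutation) (use assms in auto)
qed

lemma ex_lift_perm:
  assumes "\<tau> permutes {0..<Suc n}" "\<tau> 0 = 0"
  shows "\<exists>\<sigma>. \<sigma> permutes {0..<n} \<and> \<tau> = lift_perm \<sigma>"
proof (intro exI conjI)
  have nz: "\<tau> (Suc j) \<noteq> 0" for j
    using permutes_inj[OF assms(1)] assms(2) by (metis injD nat.distinct(1))
  show "\<tau> = lift_perm (\<lambda>j. \<tau> (Suc j) - 1)"
  proof
    fix i show "\<tau> i = lift_perm (\<lambda>j. \<tau> (Suc j) - 1) i"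
      using nz assms(2) by (cases i) auto
  qed
  show "(\<lambda>j. \<tau> (Suc j) - 1) permutes {0..<n}"
    unfolding permutes_def
  proof (intro conjI allI impI)
    fix x assume "x \<notin> {0..<n}"
    then show "\<tau> (Suc x) - 1 = x" using permutes_not_in[OF assms(1), of "Suc x"] by simp
  next
    fix y
    have "\<tau> (Suc x) - 1 = y \<longleftrightarrow> \<tau> (Suc x) = Suc y" for x
      using nz[of x] by auto
    moreover have "\<exists>!x. \<tau> x = Suc y"
      using assms(1) unfolding permutes_def by blast
    then have "\<exists>!x. \<tau> (Suc x) = Suc y"
      by (metis assms(2) nat.distinct(1) not0_implies_Suc nat.inject)
    ultimately show "\<exists>!x. \<tau> (Suc x) - 1 = y" by simp
  qed
qed

lemma rotation_permutes_sign:
  "rotation k permutes {0..<Suc k} \<and> sign (rotation k) = (- 1) ^ k"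
proof (induction k)
  case 0
  have "rotation 0 = id" by (auto simp: rotation_def fun_eq_iff)
  then show ?case by (simp add: permutes_id[unfolded id_def] id_def)
next
  case (Suc k)
  have eq: "rotation (Suc k) = rotation k \<circ> transpose k (Suc k)"
    by (auto simp: rotation_def transpose_def fun_eq_iff)
  have 1: "rotation k permutes {0..<Suc (Suc k)}"
    using Suc by (auto intro: permutes_subset)
  have 2: "transpose k (Suc k) permutes {0..<Suc (Suc k)}"
    by (rule permutes_swap_id) auto
  have "sign (rotation (Suc k)) = sign (rotation k) * sign (transpose k (Suc k))"
    unfolding eq by (rule sign_compose) (use 1 2 permutation_permutes in blast)+
  then show ?case
    using permutes_compose[OF 2 1] Suc unfolding eq[symmetric] by (simp add: sign_swap_id)
qed

text \<open>The guard \<open>Suc k \<le> n\<close> says that the second block is nonempty. For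
  \<open>k = n\<close> the set \<open>shuffles_on (Suc k) n\<close> still contains the identity, but
  \<open>rotation (Suc k)\<close> would move a point outside \<open>{0..<Suc n}\<close>.\<close>

lemma shuffles_on_Suc:
  assumes "k \<le> n"
  shows "shuffles_on (Suc k) (Suc n) = lift_perm ` shuffles_on k n \<union>
    (\<lambda>\<sigma>. lift_perm \<sigma> \<circ> rotation (Suc k)) ` {\<sigma> \<in> shuffles_on (Suc k) n. Suc k \<le> n}"
    (is "_ = ?A \<union> ?B")
proof (intro equalityI subsetI)
  fix \<tau> assume "\<tau> \<in> shuffles_on (Suc k) (Suc n)"
  then have \<tau>: "\<tau> permutes {0..<Suc n}" and m1: "strict_mono_on {0..<Suc k} \<tau>"
    and m2: "strict_mono_on {Suc k..<Suc n} \<tau>" by (auto simp: shuffles_on_def)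
  obtain i where i: "\<tau> i = 0" "i < Suc n"
    using permutes_image[OF \<tau>] by (metis atLeastLessThan_iff imageE le0 zero_less_Suc)
  show "\<tau> \<in> ?A \<union> ?B"
  proof (cases "i < Suc k")
    case True
    then have "i = 0"
      using i strict_mono_onD[OF m1, of 0 i] by fastforce
    with i obtain \<sigma> where \<sigma>: "\<sigma> permutes {0..<n}" "\<tau> = lift_perm \<sigma>"
      using ex_lift_perm[OF \<tau>] by blast
    have "\<sigma> \<in> shuffles_on k n"
      unfolding shuffles_on_def
    proof (intro CollectI conjI strict_mono_onI)
      fix r s assume rs: "r \<in> {0..<k}" "s \<in> {0..<k}" "r < s"
      then have "\<tau> (Suc r) < \<tau> (Suc s)" by (intro strict_mono_onD[OF m1]) auto
      then show "\<sigma> r < \<sigma> s" by (simp add: \<sigma>)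
    next
      fix r s assume rs: "r \<in> {k..<n}" "s \<in> {k..<n}" "r < s"
      then have "\<tau> (Suc r) < \<tau> (Suc s)" by (intro strict_mono_onD[OF m2]) auto
      then show "\<sigma> r < \<sigma> s" by (simp add: \<sigma>)
    qed (use \<sigma> in auto)
    then show ?thesis using \<sigma> by blast
  next
    case False
    then have i_eq: "i = Suc k"
      using i strict_mono_onD[OF m2, of "Suc k" i] by fastforce
    with i have kn: "Suc k \<le> n" by simp
    have rot: "rotation (Suc k) permutes {0..<Suc n}"
      using rotation_permutes_sign[of "Suc k"] kn by (auto intro: permutes_subset)
    let ?\<tau> = "\<tau> \<circ> inv (rotation (Suc k))"
    have "?\<tau> permutes {0..<Suc n}"
      by (rule permutes_compose[OF permutes_inv[OF rot] \<tau>])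
    moreover have "?\<tau> 0 = 0"
    proof -
      have "rotation (Suc k) (Suc k) = 0" by (simp add: rotation_def)
      then have "inv (rotation (Suc k)) 0 = Suc k"
        using permutes_inverses(2)[OF rot] by metis
      then show ?thesis using i i_eq by simp
    qed
    ultimately obtain \<sigma> where \<sigma>: "\<sigma> permutes {0..<n}" "?\<tau> = lift_perm \<sigma>"
      using ex_lift_perm by blast
    have \<tau>_eq: "\<tau> = lift_perm \<sigma> \<circ> rotation (Suc k)"
      using permutes_inv_o(2)[OF rot] unfolding \<sigma>(2)[symmetric] comp_assoc by simp
    have "\<sigma> \<in> shuffles_on (Suc k) n"
      unfolding shuffles_on_def
    proof (intro CollectI conjI strict_mono_onI)
      fix r s assume rs: "r \<in> {0..<Suc k}" "s \<in> {0..<Suc k}" "r < s"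
      then have "\<tau> r < \<tau> s" by (intro strict_mono_onD[OF m1]) auto
      then show "\<sigma> r < \<sigma> s" using rs by (simp add: \<tau>_eq rotation_def)
    next
      fix r s assume rs: "r \<in> {Suc k..<n}" "s \<in> {Suc k..<n}" "r < s"
      then have "\<tau> (Suc r) < \<tau> (Suc s)" by (intro strict_mono_onD[OF m2]) auto
      then show "\<sigma> r < \<sigma> s" using rs by (simp add: \<tau>_eq rotation_def)
    qed (use \<sigma> in auto)
    then show ?thesis using \<tau>_eq kn by blast
  qed
next
  fix \<tau> assume "\<tau> \<in> ?A \<union> ?B"
  then consider \<sigma> where "\<sigma> \<in> shuffles_on k n" "\<tau> = lift_perm \<sigma>"
    | \<sigma> where "\<sigma> \<in> shuffles_on (Suc k) n" "Suc k \<le> n" "\<tau> = lift_perm \<sigma> \<circ> rotation (Suc k)"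
    by blast
  then show "\<tau> \<in> shuffles_on (Suc k) (Suc n)"
  proof cases
    case 1
    then have \<sigma>: "\<sigma> permutes {0..<n}" "strict_mono_on {0..<k} \<sigma>" "strict_mono_on {k..<n} \<sigma>"
      by (auto simp: shuffles_on_def)
    show ?thesis
      unfolding shuffles_on_def 1
    proof (intro CollectI conjI strict_mono_onI lift_perm_permutes \<sigma>)
      fix r s assume "r \<in> {0..<Suc k}" "s \<in> {0..<Suc k}" "r < s"
      then show "lift_perm \<sigma> r < lift_perm \<sigma> s"
        using \<sigma>(2) by (cases r; cases s) (auto simp: strict_mono_on_def)
    next
      fix r s assume "r \<in> {Suc k..<Suc n}" "s \<in> {Suc k..<Suc n}" "r < s"
      then show "lift_perm \<sigma> r < lift_perm \<sigma> s"
        using \<sigma>(3) by (cases r; cases s) (auto simp: strict_mono_on_def)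
    qed
  next
    case 2
    then have \<sigma>: "\<sigma> permutes {0..<n}" "strict_mono_on {0..<Suc k} \<sigma>" "strict_mono_on {Suc k..<n} \<sigma>"
      by (auto simp: shuffles_on_def)
    have rot: "rotation (Suc k) permutes {0..<Suc n}"
      using rotation_permutes_sign[of "Suc k"] 2 by (auto intro: permutes_subset)
    show ?thesis
      unfolding shuffles_on_def 2
    proof (intro CollectI conjI strict_mono_onI permutes_compose rot lift_perm_permutes \<sigma>)
      fix r s assume "r \<in> {0..<Suc k}" "s \<in> {0..<Suc k}" "r < s"
      then show "(lift_perm \<sigma> \<circ> rotation (Suc k)) r < (lift_perm \<sigma> \<circ> rotation (Suc k)) s"
        using \<sigma>(2) by (auto simp: strict_mono_on_def rotation_def)
    next
      fix r s assume "r \<in> {Suc k..<Suc n}" "s \<in> {Suc k..<Suc n}" "r < s"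
      then show "(lift_perm \<sigma> \<circ> rotation (Suc k)) r < (lift_perm \<sigma> \<circ> rotation (Suc k)) s"
        using \<sigma>(3) by (cases r; cases s) (auto simp: strict_mono_on_def rotation_def)
    qed
  qed
qed

lemma finite_shuffles_on: "finite (shuffles_on k n)"
  by (rule finite_subset[OF _ finite_permutations[of "{0..<n}"]]) (auto simp: shuffles_on_def)

lemma shuffles_on_0: "shuffles_on 0 n = {id}"
proof -
  have "\<sigma> = id" if "\<sigma> permutes {0..<n}" "strict_mono_on {0..<n} \<sigma>" for \<sigma>
    using that
  proof (induction n)
    case 0
    then show ?case by simp
  next
    case (Suc n)
    \<comment> \<open>Otherwise \<open>n\<close> would be the value at some \<open>i < n\<close>,
      and monotonicity would force a value above \<open>n\<close> at \<open>n\<close>.\<close>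
    have "\<sigma> n = n"
    proof (rule ccontr)
      assume neq: "\<sigma> n \<noteq> n"
      obtain i where i: "i < Suc n" "\<sigma> i = n"
        using permutes_image[OF Suc.prems(1)] by (metis atLeastLessThan_iff imageE le0 lessI)
      with neq have "i < n" by (metis less_SucE)
      then have "\<sigma> i < \<sigma> n" using Suc.prems(2) by (intro strict_mono_onD[OF Suc.prems(2)]) auto
      moreover have "\<sigma> n < Suc n"
        using permutes_in_image[OF Suc.prems(1), of n] by simp
      ultimately show False using i by simp
    qed
    then have "\<sigma> permutes {0..<n}"
      by (intro permutes_superset[OF Suc.prems(1)]) (auto simp: less_Suc_eq)
    then show ?case
      using Suc.prems(2) by (intro Suc.IH) (auto simp: strict_mono_on_def)
  qed
  then show ?thesis by (auto simp: shuffles_on_def permutes_id strict_mono_on_def)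
qed

lemma shuffles_on_fix_last:
  assumes "q > 0"
  shows "{\<sigma> \<in> shuffles_on p (p + q). \<sigma> (p + q - 1) = p + q - 1} = shuffles_on p (p + q - 1)"
proof (intro equalityI subsetI)
  fix \<sigma> assume "\<sigma> \<in> {\<sigma> \<in> shuffles_on p (p + q). \<sigma> (p + q - 1) = p + q - 1}"
  then have \<sigma>: "\<sigma> permutes {0..<p + q}" "strict_mono_on {0..<p} \<sigma>" "strict_mono_on {p..<p + q} \<sigma>"
     and last: "\<sigma> (p + q - 1) = p + q - 1" by (auto simp: shuffles_on_def)
  have "\<sigma> x = x" if "x \<in> {0..<p + q} - {0..<p + q - 1}" for x
  proof -
    have "x = p + q - 1" using that by auto
    then show ?thesis using last by simp
  qed
  then have "\<sigma> permutes {0..<p + q - 1}"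
    by (rule permutes_superset[OF \<sigma>(1)])
  then show "\<sigma> \<in> shuffles_on p (p + q - 1)"
    using \<sigma>(2) strict_mono_onD[OF \<sigma>(3)] by (auto simp: shuffles_on_def intro!: strict_mono_onI)
next
  fix \<sigma> assume "\<sigma> \<in> shuffles_on p (p + q - 1)"
  then have \<sigma>: "\<sigma> permutes {0..<p + q - 1}" "strict_mono_on {0..<p} \<sigma>"
      "strict_mono_on {p..<p + q - 1} \<sigma>"
    by (auto simp: shuffles_on_def)
  have last: "\<sigma> (p + q - 1) = p + q - 1"
    using permutes_not_in[OF \<sigma>(1)] by simp
  have "\<sigma> r < \<sigma> s" if "r \<in> {p..<p + q}" "s \<in> {p..<p + q}" "r < s" for r s
  proof (cases "s = p + q - 1")
    case True
    then show ?thesis using that last permutes_in_image[OF \<sigma>(1), of r] by simp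
  next
    case False
    then show ?thesis using that by (intro strict_mono_onD[OF \<sigma>(3)]) auto
  qed
  then show "\<sigma> \<in> {\<sigma> \<in> shuffles_on p (p + q). \<sigma> (p + q - 1) = p + q - 1}"
    using \<sigma> last permutes_subset[OF \<sigma>(1), of "{0..<p + q}"]
    by (auto simp: shuffles_on_def intro: strict_mono_onI)
qed

lemma select_id: "n \<le> length Xs \<Longrightarrow> select Xs id 0 n = take n Xs" "select Xs \<sigma> n n = []"
  by (auto simp: select_def intro: nth_equalityI)

lemma select_lift_perm:
  "select (X # Xs) (lift_perm \<sigma>) 0 (Suc k) = X # select Xs \<sigma> 0 k"
  "select (X # Xs) (lift_perm \<sigma>) (Suc k) (Suc n) = select Xs \<sigma> k n"
  by (simp_all add: select_def upt_conv_Cons map_Suc_upt[symmetric] del: upt_Suc)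

lemma select_lift_perm_rotation:
  "select (X # Xs) (lift_perm \<sigma> \<circ> rotation (Suc k)) 0 (Suc k) = select Xs \<sigma> 0 (Suc k)"
  "Suc k \<le> n \<Longrightarrow>
    select (X # Xs) (lift_perm \<sigma> \<circ> rotation (Suc k)) (Suc k) (Suc n) = X # select Xs \<sigma> (Suc k) n"
proof -
  show "select (X # Xs) (lift_perm \<sigma> \<circ> rotation (Suc k)) 0 (Suc k) = select Xs \<sigma> 0 (Suc k)"
    by (simp add: select_def rotation_def del: upt_Suc)
  assume "Suc k \<le> n"
  then have "[Suc k..<Suc n] = Suc k # map Suc [Suc k..<n]"
    by (simp add: upt_conv_Cons map_Suc_upt del: upt_Suc)
  then show "select (X # Xs) (lift_perm \<sigma> \<circ> rotation (Suc k)) (Suc k) (Suc n) =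
      X # select Xs \<sigma> (Suc k) n"
    by (simp add: select_def rotation_def del: upt_Suc)
qed

text \<open>As a function of the lists \<open>As\<close> and \<open>Bs\<close> taken by
  \<open>F\<close> and \<open>G\<close>, the summand fits \<open>shuffle_sum\<close>. The receiving
  pair is read from \<open>Xs\<close> at position \<open>k + q\<close>, just behind the positions
  that are shuffled.\<close>

definition insertion_term :: "nat \<Rightarrow> nat \<Rightarrow> (('g \<times> 'g) list \<Rightarrow> 'b::ab_group_add) \<Rightarrow>
    (('g \<times> 'g) list \<Rightarrow> 'g \<Rightarrow> 'g) \<Rightarrow>
    ('g \<times> 'g) list \<Rightarrow> ('g \<times> 'g) list \<Rightarrow> ('g \<times> 'g) list \<Rightarrow> 'b" where
  "insertion_term k q F G Xs As Bs =
    F (As @ (fst (Xs ! (k + q)), G Bs (snd (Xs ! (k + q)))) # drop (k + q + 1) Xs) +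
    F (As @ (G Bs (fst (Xs ! (k + q))), snd (Xs ! (k + q))) # drop (k + q + 1) Xs)"

lemma insertion_term_Cons:
  "insertion_term (Suc k) q F G (X # Xs) (X # As) Bs =
      insertion_term k q (\<lambda>Ys. F (X # Ys)) G Xs As Bs"
  "insertion_term k (Suc q) F G (X # Xs) As (X # Bs) =
      insertion_term k q F (\<lambda>Ys. G (X # Ys)) Xs As Bs"
  by (simp_all add: insertion_term_def)

definition shuffle_sum :: "('k::field \<Rightarrow> 'b::ab_group_add \<Rightarrow> 'b) \<Rightarrow> nat \<Rightarrow> nat \<Rightarrow>
    ('c list \<Rightarrow> 'c list \<Rightarrow> 'b) \<Rightarrow> 'c list \<Rightarrow> 'b" where
  "shuffle_sum scale k n \<Phi> Xs =
    (\<Sum>\<sigma>\<in>shuffles_on k n. scale (of_int (sign \<sigma>)) (\<Phi> (select Xs \<sigma> 0 k) (select Xs \<sigma> k n)))"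

section \<open>Agreement of the recursive insertions with the shuffle sums\<close>

context vector_space
begin

lemma scale_minus_one_power: "scale ((- 1) ^ n) x = sg n x"
  by (simp add: sg_def)

lemma shuffle_sum_0: "n \<le> length Xs \<Longrightarrow> shuffle_sum scale 0 n \<Phi> Xs = \<Phi> [] (take n Xs)"
  by (simp add: shuffle_sum_def shuffles_on_0 select_id)

lemma shuffle_sum_add:
  "shuffle_sum scale k n (\<lambda>As Bs. \<Phi> As Bs + \<Psi> As Bs) Xs =
      shuffle_sum scale k n \<Phi> Xs + shuffle_sum scale k n \<Psi> Xs"
  by (simp add: shuffle_sum_def scale_right_distrib sum.distrib)

text \<open>In the second summand \<open>X\<close> heads the second list and has passed the
  \<open>Suc k\<close> pairs of the first one; the sign is that of
  \<open>rotation (Suc k)\<close>.\<close>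

lemma shuffle_sum_Suc:
  assumes "k \<le> n"
  shows "shuffle_sum scale (Suc k) (Suc n) \<Phi> (X # Xs) =
      shuffle_sum scale k n (\<lambda>As Bs. \<Phi> (X # As) Bs) Xs +
    (if Suc k \<le> n then sg (Suc k) (shuffle_sum scale (Suc k) n (\<lambda>As Bs. \<Phi> As (X # Bs)) Xs) else 0)"
proof -
  let ?f = "\<lambda>\<sigma>. scale (of_int (sign \<sigma>)) (\<Phi> (select (X # Xs) \<sigma> 0 (Suc k)) (select (X # Xs) \<sigma> (Suc k) (Suc n)))"
  let ?B = "{\<sigma> \<in> shuffles_on (Suc k) n. Suc k \<le> n}"
  let ?r = "\<lambda>\<sigma>. lift_perm \<sigma> \<circ> rotation (Suc k)"
  have "sum ?f (shuffles_on (Suc k) (Suc n)) =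
      sum ?f (lift_perm ` shuffles_on k n) + sum ?f (?r ` ?B)"
    unfolding shuffles_on_Suc[OF assms]
  proof (rule sum.union_disjoint)
    have "lift_perm \<sigma> \<noteq> ?r \<tau>" for \<sigma> \<tau>
    proof
      assume "lift_perm \<sigma> = ?r \<tau>"
      then have "lift_perm \<sigma> 0 = ?r \<tau> 0" by simp
      then show False by (simp add: rotation_def)
    qed
    then show "lift_perm ` shuffles_on k n \<inter> ?r ` ?B = {}" by blast
  qed (simp_all add: finite_shuffles_on)
  moreover have "sum ?f (lift_perm ` shuffles_on k n) =
      shuffle_sum scale k n (\<lambda>As Bs. \<Phi> (X # As) Bs) Xs"
  proof -
    have "sum ?f (lift_perm ` shuffles_on k n) = (\<Sum>\<sigma>\<in>shuffles_on k n. ?f (lift_perm \<sigma>))"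
      by (rule sum.reindex[unfolded o_def]) (use inj_lift_perm in \<open>auto intro: inj_on_subset\<close>)
    also have "\<dots> = shuffle_sum scale k n (\<lambda>As Bs. \<Phi> (X # As) Bs) Xs"
      unfolding shuffle_sum_def
      by (rule sum.cong) (auto simp: select_lift_perm lift_perm_permutes(2) shuffles_on_def)
    finally show ?thesis .
  qed
  moreover have "sum ?f (?r ` ?B) =
    (if Suc k \<le> n then sg (Suc k) (shuffle_sum scale (Suc k) n (\<lambda>As Bs. \<Phi> As (X # Bs)) Xs) else 0)"
  proof (cases "Suc k \<le> n")
    case True
    have rot: "rotation (Suc k) permutes {0..<Suc n}" "sign (rotation (Suc k)) = (- 1) ^ Suc k"
      using rotation_permutes_sign[of "Suc k"] True by (auto intro: permutes_subset)
    have sgn: "sign (?r \<sigma>) = (- 1) ^ Suc k * sign \<sigma>" if "\<sigma> permutes {0..<n}" for \<sigma>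
    proof -
      have "sign (?r \<sigma>) = sign (lift_perm \<sigma>) * sign (rotation (Suc k))"
        by (rule sign_compose) (use rot lift_perm_permutes[OF that] permutation_permutes in blast)+
      then show ?thesis using rot(2) lift_perm_permutes(2)[OF that] by simp
    qed
    have "inj_on ?r ?B"
    proof (rule inj_onI)
      fix \<sigma> \<tau> assume "?r \<sigma> = ?r \<tau>"
      then have "?r \<sigma> \<circ> inv (rotation (Suc k)) = ?r \<tau> \<circ> inv (rotation (Suc k))" by simp
      then have "lift_perm \<sigma> = lift_perm \<tau>"
        unfolding comp_assoc permutes_inv_o(1)[OF rot(1)] by simp
      then show "\<sigma> = \<tau>" using inj_lift_perm by (simp add: inj_eq)
    qed
    then have "sum ?f (?r ` ?B) = (\<Sum>\<sigma>\<in>?B. ?f (?r \<sigma>))"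
      by (rule sum.reindex[unfolded o_def])
    also have "\<dots> = (\<Sum>\<sigma>\<in>shuffles_on (Suc k) n. scale ((- 1) ^ Suc k)
        (scale (of_int (sign \<sigma>)) (\<Phi> (select Xs \<sigma> 0 (Suc k)) (X # select Xs \<sigma> (Suc k) n))))"
    proof (rule sum.cong)
      fix \<sigma> assume "\<sigma> \<in> shuffles_on (Suc k) n"
      then have "sign (?r \<sigma>) = (- 1) ^ Suc k * sign \<sigma>"
        by (intro sgn) (simp add: shuffles_on_def)
      then show "?f (?r \<sigma>) = scale ((- 1) ^ Suc k)
        (scale (of_int (sign \<sigma>)) (\<Phi> (select Xs \<sigma> 0 (Suc k)) (X # select Xs \<sigma> (Suc k) n)))"
        unfolding select_lift_perm_rotation(1) select_lift_perm_rotation(2)[OF True] scale_scale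
        by simp
    qed (use True in auto)
    also have "\<dots> = sg (Suc k) (shuffle_sum scale (Suc k) n (\<lambda>As Bs. \<Phi> As (X # Bs)) Xs)"
      unfolding scale_sum_right[symmetric] unfolding shuffle_sum_def scale_minus_one_power ..
    finally show ?thesis using True by simp
  qed auto
  ultimately show ?thesis unfolding shuffle_sum_def by simp
qed

text \<open>Both sides obey the same recursion: if \<open>X\<close> goes to \<open>G\<close>, the
  sign \<open>(-1)^p\<close> of \<open>shuffle_sum_Suc\<close> turns \<open>(-1)^(p * q)\<close>
  into \<open>(-1)^(p * (q - 1))\<close>; if it goes to \<open>F\<close>, lowering \<open>p\<close>
  leaves \<open>(-1)^q\<close>.\<close>

lemma last_ins_shuffle_sum:
  "length Xs = p + q \<Longrightarrow>
    last_ins q F G Xs = sg (p * q) (shuffle_sum scale p (p + q) (\<lambda>As Bs. F As (G Bs)) Xs)"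
proof (induction Xs arbitrary: p q F G)
  case Nil
  then show ?case by (simp add: shuffle_sum_0)
next
  case (Cons X Xs)
  show ?case
  proof (cases p)
    case 0
    then obtain q' where q: "q = Suc q'" using Cons.prems by (cases q) auto
    have "last_ins q' F (\<lambda>Ys. G (X # Ys)) Xs = F [] (G (X # Xs))"
      using Cons.IH[of 0 q' F "\<lambda>Ys. G (X # Ys)"] Cons.prems 0 q by (simp add: shuffle_sum_0)
    then show ?thesis using 0 q Cons.prems by (simp add: shuffle_sum_0 last_ins_short)
  next
    case p: (Suc p')
    show ?thesis
    proof (cases q)
      case 0
      then show ?thesis
        using Cons.IH[of p' 0 "\<lambda>Ys. F (X # Ys)" G] Cons.prems p
        by (simp add: shuffle_sum_Suc)
    next
      case (Suc q')
      show ?thesis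
        using Cons.IH[of p' q "\<lambda>Ys. F (X # Ys)" G] Cons.IH[of p q' F "\<lambda>Ys. G (X # Ys)"] Cons.prems p
            Suc
        by (simp add: shuffle_sum_Suc sg_add sg_sg) (simp add: sg_def)
    qed
  qed
qed

lemma insertion_sum_eq_shuffle_sum:
  "insertion_sum scale p q F G Xs =
    (\<Sum>k<p. sg (k * q) (shuffle_sum scale k (k + q) (insertion_term k q F G Xs) Xs))"
  unfolding insertion_sum_def insertion_term_def shuffle_sum_add sg_add sum.distrib
  by (simp add: shuffle_sum_def scale_minus_one_power)

text \<open>The index \<open>k\<close> counts the pairs of \<open>F\<close> in front of the
  receiving pair. The term \<open>k = 0\<close> is split off: there \<open>X\<close> is itself the
  receiving pair if \<open>q = 0\<close>, and the first pair of \<open>G\<close> otherwise. The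
  terms with \<open>k > 0\<close> follow \<open>shuffle_sum_Suc\<close>.\<close>

lemma pair_ins_eq_insertion_sum:
  "length Xs = p + q \<Longrightarrow> pair_ins q F G Xs = insertion_sum scale p q F G Xs"
proof (induction Xs arbitrary: p q F G)
  case Nil
  then show ?case by (simp add: insertion_sum_def)
next
  case (Cons X Xs)
  obtain x y where X: "X = (x, y)" by fastforce
  show ?case
  proof (cases p)
    case 0
    then show ?thesis using Cons.prems by (simp add: insertion_sum_def pair_ins_short)
  next
    case p: (Suc p')
    show ?thesis
    proof (cases q)
      case 0
      have "pair_ins 0 F G (X # Xs) = insertion_sum scale p' 0 (\<lambda>Ys. F (X # Ys)) G Xs +
          F ((x, G [] y) # Xs) + F ((G [] x, y) # Xs)"
        using Cons.IH[of p' 0 "\<lambda>Ys. F (X # Ys)" G] Cons.prems p 0 by (simp add: X)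
      also have "\<dots> = insertion_sum scale p 0 F G (X # Xs)"
        unfolding insertion_sum_eq_shuffle_sum p sum.lessThan_Suc_shift
        by (simp add: shuffle_sum_0 shuffle_sum_Suc insertion_term_Cons)
          (simp add: insertion_term_def X)
      finally show ?thesis using 0 by simp
    next
      case q: (Suc q')
      have first: "shuffle_sum scale 0 (Suc q') (insertion_term 0 (Suc q') F G (X # Xs)) (X # Xs)
          = shuffle_sum scale 0 q' (insertion_term 0 q' F (\<lambda>Ys. G (X # Ys)) Xs) Xs"
        using Cons.prems p q by (simp add: shuffle_sum_0 insertion_term_Cons)
      have "insertion_sum scale p q F G (X # Xs) =
          sg q (insertion_sum scale p' q (\<lambda>Ys. F (X # Ys)) G Xs) +
          insertion_sum scale p q' F (\<lambda>Ys. G (X # Ys)) Xs"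
        unfolding insertion_sum_eq_shuffle_sum p q sum.lessThan_Suc_shift[of _ p']
        by (simp add: first shuffle_sum_Suc insertion_term_Cons sg_add sg_sg sg_sum sum.distrib)
          (cases "even q'"; simp add: sg_def)
      then show ?thesis
        using Cons.IH[of p' q "\<lambda>Ys. F (X # Ys)" G] Cons.IH[of p q' F "\<lambda>Ys. G (X # Ys)"] Cons.prems p
            q
        by simp
    qed
  qed
qed

lemma pair_ins_eq_derivation_sum:
  "length Xs = p \<Longrightarrow> pair_ins 0 F G Xs = derivation_sum p F (G []) Xs"
proof (induction Xs arbitrary: p F)
  case Nil
  then show ?case by (simp add: derivation_sum_def)
next
  case (Cons X Xs)
  then obtain p' where "p = Suc p'" "length Xs = p'" by auto
  then show ?case
    using Cons.IH[of p' "\<lambda>Ys. F (X # Ys)"]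
    by (cases X) (simp add: derivation_sum_def sum.lessThan_Suc_shift[of _ p'] add_ac del: sum.lessThan_Suc)
qed

end

section \<open>Multilinearity\<close>

text \<open>
  Linearity, alternating bilinearity and homogeneity are all \<open>linear_closed\<close>,
  so that they pass to insertions by one and the same induction.
\<close>

definition linear_closed :: "('k::field \<Rightarrow> 'b::ab_group_add \<Rightarrow> 'b) \<Rightarrow> (('z \<Rightarrow> 'b) \<Rightarrow> bool) \<Rightarrow> bool" where
  "linear_closed scale C \<longleftrightarrow> C (\<lambda>z. 0) \<and> (\<forall>f g. C f \<longrightarrow> C g \<longrightarrow> C (\<lambda>z. f z + g z)) \<and>
    (\<forall>h f. Vector_Spaces.linear scale scale h \<longrightarrow> C f \<longrightarrow> C (\<lambda>z. h (f z)))"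

definition alternating_bilinear :: "('k::field \<Rightarrow> 'b::ab_group_add \<Rightarrow> 'b) \<Rightarrow> ('b \<times> 'b \<Rightarrow> 'b) \<Rightarrow> bool"
    where
  "alternating_bilinear scale h \<longleftrightarrow> (\<forall>y. Vector_Spaces.linear scale scale (\<lambda>x. h (x, y))) \<and>
    (\<forall>x. Vector_Spaces.linear scale scale (\<lambda>y. h (x, y))) \<and> (\<forall>x. h (x, x) = 0)"

text \<open>In contrast to \<open>wedge_multilinear\<close> no length is prescribed, so the property
  survives fixing a pair and adding functions of different degrees.\<close>

definition pair_linear :: "('k::field \<Rightarrow> 'b::ab_group_add \<Rightarrow> 'b) \<Rightarrow> (('b \<times> 'b) list \<Rightarrow> 'b) \<Rightarrow> bool" where
  "pair_linear scale F \<longleftrightarrow> (\<forall>As Bs. alternating_bilinear scale (\<lambda>Z. F (As @ Z # Bs)))"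

lemma pair_linearD: "pair_linear scale F \<Longrightarrow> alternating_bilinear scale (\<lambda>Z. F (As @ Z # Bs))"
  by (simp add: pair_linear_def)

lemma pair_linear_Cons: "pair_linear scale F \<Longrightarrow> pair_linear scale (\<lambda>Ys. F (X # Ys))"
  unfolding pair_linear_def
proof (intro allI)
  fix As Bs assume "\<forall>As Bs. alternating_bilinear scale (\<lambda>Z. F (As @ Z # Bs))"
  from this[rule_format, of "X # As" Bs] show "alternating_bilinear scale (\<lambda>Z. F (X # As @ Z # Bs))"
    by simp
qed

lemma pair_linear_snoc: "pair_linear scale F \<Longrightarrow> pair_linear scale (\<lambda>Ys. F (Ys @ [X]))"
  unfolding pair_linear_def by simp

lemma linear_imp_additive: "Vector_Spaces.linear scale scale h \<Longrightarrow> additive h"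
  by (auto simp: Vector_Spaces.linear_iff additive_def)

lemma pair_linear_imp_additive: "pair_linear scale F \<Longrightarrow> pair_additive F"
  by (simp add: pair_linear_def pair_additive_def alternating_bilinear_def
      linear_imp_additive[of scale])

context
  fixes scale :: "'k::field \<Rightarrow> 'b::ab_group_add \<Rightarrow> 'b"
  assumes vs: "vector_space scale"
begin

interpretation vector_space scale by (fact vs)

lemma linear_sg: "Vector_Spaces.linear scale scale (sg n)"
  using vs by (simp add: Vector_Spaces.linear_iff sg_def)

lemma linear_closed_linear: "linear_closed scale (Vector_Spaces.linear scale scale)"
  using vs by (simp add: linear_closed_def Vector_Spaces.linear_iff scale_right_distrib algebra_simps)

lemma linear_closed_alternating: "linear_closed scale (alternating_bilinear scale)"
  using vs by (simp add: linear_closed_def Vector_Spaces.linear_iff alternating_bilinear_def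
      algebra_simps scale_right_distrib)
    (metis add_cancel_right_right)

text \<open>Polarisation of \<open>h (x + y, x + y) = 0\<close>.\<close>

lemma alternating_bilinear_swap:
  assumes "alternating_bilinear scale h"
  shows "h (x, y) + h (y, x) = 0"
proof -
  have add: "h (u + v, w) = h (u, w) + h (v, w)" "h (w, u + v) = h (w, u) + h (w, v)"
    and diag: "h (u, u) = 0" for u v w
    using assms by (simp_all add: alternating_bilinear_def Vector_Spaces.linear_iff)
  then have "h (x, y) + h (y, x) = h (x + y, x + y)"
    unfolding add diag[of x] diag[of y] by simp
  then show ?thesis by (simp only: diag)
qed

context
  fixes C :: "('z \<Rightarrow> 'b) \<Rightarrow> bool"
  assumes C: "linear_closed scale C"
begin

lemma linear_closed_zero: "C (\<lambda>z. 0)"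
  and linear_closed_add: "C f \<Longrightarrow> C g \<Longrightarrow> C (\<lambda>z. f z + g z)"
  and linear_closed_compose: "Vector_Spaces.linear scale scale h \<Longrightarrow> C f \<Longrightarrow> C (\<lambda>z. h (f z))"
  using C by (auto simp: linear_closed_def)

lemma linear_closed_sg: "C f \<Longrightarrow> C (\<lambda>z. sg n (f z))"
  by (rule linear_closed_compose[OF linear_sg])

lemma linear_closed_pair_ins_left: "(\<And>Ys. C (\<lambda>z. H z Ys)) \<Longrightarrow> C (\<lambda>z. pair_ins q (H z) G Xs)"
proof (induction Xs arbitrary: q H G)
  case (Cons X Xs)
  then show ?case by (cases X; cases q) (simp_all add: linear_closed_add linear_closed_sg)
qed (simp add: linear_closed_zero)

lemma linear_closed_last_ins_left: "(\<And>Ys x. C (\<lambda>z. H z Ys x)) \<Longrightarrow> C (\<lambda>z. last_ins q (H z) G Xs)"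
proof (induction Xs arbitrary: q H G)
  case (Cons X Xs)
  then show ?case by (cases q) (simp_all add: linear_closed_add linear_closed_sg)
next
  case Nil
  then show ?case by (cases q) (simp_all add: linear_closed_zero)
qed

lemma linear_closed_pair_ins_right:
  "pair_linear scale F \<Longrightarrow> (\<And>Ys x. C (\<lambda>z. K z Ys x)) \<Longrightarrow> C (\<lambda>z. pair_ins q F (K z) Xs)"
proof (induction Xs arbitrary: q F K)
  case (Cons X Xs)
  obtain x y where X: "X = (x, y)" by fastforce
  have "Vector_Spaces.linear scale scale (\<lambda>x. F ((x, y) # Xs))"
      "Vector_Spaces.linear scale scale (\<lambda>y. F ((x, y) # Xs))"
    using pair_linearD[OF Cons.prems(1), of "[]" Xs] by (auto simp: alternating_bilinear_def)
  note lin = linear_closed_compose[OF this(1)] linear_closed_compose[OF this(2)]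
  show ?case
  proof (cases q)
    case 0
    have "C (\<lambda>z. pair_ins 0 (\<lambda>Ys. F (X # Ys)) (K z) Xs)"
      by (rule Cons.IH[OF pair_linear_Cons[OF Cons.prems(1)] Cons.prems(2)])
    then show ?thesis unfolding 0 X pair_ins.simps
      by (intro linear_closed_add lin Cons.prems)
  next
    case (Suc q')
    have "C (\<lambda>z. pair_ins q (\<lambda>Ys. F (X # Ys)) (K z) Xs)"
      by (rule Cons.IH[OF pair_linear_Cons[OF Cons.prems(1)] Cons.prems(2)])
    moreover have "C (\<lambda>z. pair_ins q' F (\<lambda>Ys. K z (X # Ys)) Xs)"
      by (rule Cons.IH) (use Cons.prems in auto)
    ultimately show ?thesis unfolding Suc pair_ins.simps
      by (intro linear_closed_add linear_closed_sg)
  qed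
qed (simp add: linear_closed_zero)

lemma linear_closed_last_ins_right:
  "(\<And>Ys. Vector_Spaces.linear scale scale (F Ys)) \<Longrightarrow> (\<And>Ys. C (\<lambda>z. K z Ys)) \<Longrightarrow>
      C (\<lambda>z. last_ins q F (K z) Xs)"
proof (induction Xs arbitrary: q F K)
  case (Cons X Xs)
  show ?case
  proof (cases q)
    case 0
    then show ?thesis by (simp add: linear_closed_compose[OF Cons.prems])
  next
    case (Suc q')
    have "C (\<lambda>z. last_ins q (\<lambda>Ys. F (X # Ys)) (K z) Xs)"
      by (rule Cons.IH[OF Cons.prems])
    moreover have "C (\<lambda>z. last_ins q' F (\<lambda>Ys. K z (X # Ys)) Xs)"
      by (rule Cons.IH) (use Cons.prems in auto)
    ultimately show ?thesis unfolding Suc last_ins.simps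
      by (intro linear_closed_add linear_closed_sg)
  qed
next
  case Nil
  show ?case
    by (cases q) (simp_all add: linear_closed_zero linear_closed_compose[OF Nil])
qed

end

lemma pair_linear_pair_ins:
  assumes "pair_linear scale F" "\<And>Ys. Vector_Spaces.linear scale scale (G Ys)"
    "\<And>x. pair_linear scale (\<lambda>Ys. G Ys x)"
  shows "pair_linear scale (pair_ins q F G)"
proof -
  note alt = linear_closed_alternating
  have "alternating_bilinear scale (\<lambda>Z. pair_ins q F G (As @ Z # Bs))" for As Bs
    using assms
  proof (induction As arbitrary: q F G)
    case Nil
    note F = pair_linearD[OF Nil(1), of "[]", simplified]
    note G = pair_linearD[OF Nil(3), of "[]", simplified]
    have 1: "alternating_bilinear scale (\<lambda>Z. pair_ins q (\<lambda>Ys. F (Z # Ys)) G Bs)"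
      by (rule linear_closed_pair_ins_left[OF alt, of "\<lambda>Z Ys. F (Z # Ys)"]) (rule F)
    show ?case
    proof (cases q)
      case 0
      \<comment> \<open>Only the sum is alternating: at \<open>(x, x)\<close> the two summands arise
        from each other by swapping the vectors of the pair, so they cancel.\<close>
      have "alternating_bilinear scale (\<lambda>Z. F ((fst Z, G [] (snd Z)) # Bs) +
          F ((G [] (fst Z), snd Z) # Bs))"
        using F[of Bs] Nil(2)[of "[]"] alternating_bilinear_swap[OF F[of Bs]]
        by (simp add: alternating_bilinear_def Vector_Spaces.linear_iff algebra_simps scale_right_distrib)
      moreover have "(\<lambda>Z. pair_ins 0 F G (Z # Bs)) = (\<lambda>Z. pair_ins 0 (\<lambda>Ys. F (Z # Ys)) G Bs +
          (F ((fst Z, G [] (snd Z)) # Bs) + F ((G [] (fst Z), snd Z) # Bs)))"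
        by (simp add: fun_eq_iff split_paired_all add.assoc)
      ultimately show ?thesis
        unfolding 0 append_Nil using 1[unfolded 0] by (simp add: linear_closed_add[OF alt])
    next
      case (Suc q')
      have "alternating_bilinear scale (\<lambda>Z. pair_ins q' F (\<lambda>Ys. G (Z # Ys)) Bs)"
        by (rule linear_closed_pair_ins_right[OF alt Nil(1), of "\<lambda>Z Ys. G (Z # Ys)"]) (rule G)
      then show ?thesis
        using 1 by (simp add: Suc linear_closed_add[OF alt] linear_closed_sg[OF alt])
    qed
  next
    case (Cons X As)
    obtain x y where X: "X = (x, y)" by fastforce
    have F: "alternating_bilinear scale (\<lambda>Z. F (Y # As @ Z # Bs))" for Y
      using pair_linearD[OF Cons.prems(1), of "Y # As" Bs] by simp
    have 1: "alternating_bilinear scale (\<lambda>Z. pair_ins q (\<lambda>Ys. F (X # Ys)) G (As @ Z # Bs))"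
      by (rule Cons.IH) (use Cons.prems pair_linear_Cons[OF Cons.prems(1)] in auto)
    show ?case
    proof (cases q)
      case 0
      then show ?thesis using 1 F by (simp add: X linear_closed_add[OF alt])
    next
      case (Suc q')
      have "alternating_bilinear scale (\<lambda>Z. pair_ins q' F (\<lambda>Ys. G (X # Ys)) (As @ Z # Bs))"
        by (rule Cons.IH) (use Cons.prems in \<open>auto intro: pair_linear_Cons[of scale "\<lambda>Ys. G Ys x" for x]\<close>)
      then show ?thesis using Suc 1
          by (simp add: linear_closed_add[OF alt] linear_closed_sg[OF alt])
    qed
  qed
  then show ?thesis by (simp add: pair_linear_def)
qed

lemma pair_linear_last_ins:
  assumes "\<And>Ys. Vector_Spaces.linear scale scale (F Ys)" "\<And>x. pair_linear scale (\<lambda>Ys. F Ys x)"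
    "pair_linear scale G"
  shows "pair_linear scale (last_ins q F G)"
proof -
  note alt = linear_closed_alternating
  have "alternating_bilinear scale (\<lambda>Z. last_ins q F G (As @ Z # Bs))" for As Bs
    using assms
  proof (induction As arbitrary: q F G)
    case Nil
    note F = pair_linearD[OF Nil(2), of "[]", simplified]
    note G = pair_linearD[OF Nil(3), of "[]", simplified]
    show ?case
    proof (cases q)
      case 0
      then show ?thesis using F by simp
    next
      case (Suc q')
      have 1: "alternating_bilinear scale (\<lambda>Z. last_ins q (\<lambda>Ys. F (Z # Ys)) G Bs)"
        by (rule linear_closed_last_ins_left[OF alt, of "\<lambda>Z Ys. F (Z # Ys)"]) (rule F)
      then show ?thesis
        unfolding Suc last_ins.simps append_Nil
        by (intro linear_closed_add[OF alt] linear_closed_sg[OF alt]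
            linear_closed_last_ins_right[OF alt Nil(1)] G)
    qed
  next
    case (Cons X As)
    have F: "alternating_bilinear scale (\<lambda>Z. F (X # As @ Z # Bs) x)" for x
      using pair_linearD[OF Cons.prems(2), of "X # As" Bs] by simp
    have 1: "alternating_bilinear scale (\<lambda>Z. last_ins q (\<lambda>Ys. F (X # Ys)) G (As @ Z # Bs))"
      by (rule Cons.IH) (use Cons.prems in \<open>auto intro: pair_linear_Cons[of scale "\<lambda>Ys. F Ys x" for x]\<close>)
    show ?case
    proof (cases q)
      case 0
      then show ?thesis using F by simp
    next
      case (Suc q')
      have "alternating_bilinear scale (\<lambda>Z. last_ins q' F (\<lambda>Ys. G (X # Ys)) (As @ Z # Bs))"
        by (rule Cons.IH) (use Cons.prems pair_linear_Cons[OF Cons.prems(3)] in auto)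
      then show ?thesis using Suc 1
          by (simp add: linear_closed_add[OF alt] linear_closed_sg[OF alt])
    qed
  qed
  then show ?thesis by (simp add: pair_linear_def)
qed

lemma pair_linear_add: "pair_linear scale F \<Longrightarrow> pair_linear scale G \<Longrightarrow>
    pair_linear scale (\<lambda>Xs. F Xs + G Xs)"
  unfolding pair_linear_def by (simp add: linear_closed_add[OF linear_closed_alternating])

lemma pair_linear_snoc_ins:
  assumes "\<And>Ys. Vector_Spaces.linear scale scale (F Ys)" "\<And>x. pair_linear scale (\<lambda>Ys. F Ys x)"
    "pair_linear scale G"
  shows "pair_linear scale (snoc_ins p q F G)"
proof (cases "q = 0")
  case True
  then show ?thesis
    by (simp add: pair_linear_def snoc_ins_def linear_closed_zero[OF linear_closed_alternating])
next
  case False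
  note alt = linear_closed_alternating
  have "alternating_bilinear scale (\<lambda>Z. snoc_ins p q F G (As @ Z # Bs))" for As Bs
  \<comment> \<open>If \<open>Bs\<close> is empty, \<open>Z\<close> is the last pair, which
    \<open>snoc_ins\<close> hands to \<open>G\<close> directly; otherwise \<open>Z\<close> is among
    the pairs distributed by \<open>last_ins\<close>.\<close>
  proof (cases Bs rule: rev_cases)
    case Nil
    have "alternating_bilinear scale (\<lambda>Z. last_ins (q - 1) F (\<lambda>Ys. G (Ys @ [Z])) As)"
      by (rule linear_closed_last_ins_right[OF alt assms(1)])
          (use pair_linearD[OF assms(3)] in auto)
    then show ?thesis using False Nil by (simp add: snoc_ins_snoc linear_closed_sg[OF alt])
  next
    case (snoc Bs' X)
    have "pair_linear scale (last_ins (q - 1) F (\<lambda>Ys. G (Ys @ [X])))"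
      by (intro pair_linear_last_ins assms pair_linear_snoc)
    from pair_linearD[OF this, of As Bs'] show ?thesis
      using False snoc snoc_ins_snoc[of q p F G "As @ Z # Bs'" X for Z]
          by (simp add: linear_closed_sg[OF alt])
  qed
  then show ?thesis by (simp add: pair_linear_def)
qed

end

section \<open>The graded Lie algebra of cochains\<close>

text \<open>The part of the cochain conditions that mentions no degree. It passes to sums of
  cochains of different degrees, so bilinearity of the bracket on the direct sum can be proved
  without decomposing into components. The condition on \<open>[]\<close> reflects that degree 0 has
  no first component.\<close>

definition multilinear_cochain :: "('k::field \<Rightarrow> 'b::ab_group_add \<Rightarrow> 'b) \<Rightarrow> 'b cochain \<Rightarrow> bool" where
  "multilinear_cochain scale P \<longleftrightarrow> fst P [] = 0 \<and> pair_linear scale (fst P) \<and>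
    (\<forall>x. pair_linear scale (\<lambda>Xs. snd P Xs x)) \<and> (\<forall>Xs. Vector_Spaces.linear scale scale (snd P Xs))"

lemma pair_linear_imp_wedge_multilinear:
  assumes "pair_linear scale F"
  shows "wedge_multilinear scale p F"
  unfolding wedge_multilinear_def
proof (intro allI impI)
  fix Xs :: "('b \<times> 'b) list" and i assume "length Xs = p" "i < p"
  then have "Xs[i := Z] = take i Xs @ Z # drop (Suc i) Xs" for Z
    by (simp add: upd_conv_take_nth_drop)
  then show "(\<forall>y. Vector_Spaces.linear scale scale (\<lambda>x. F (Xs[i := (x, y)]))) \<and>
      (\<forall>x. Vector_Spaces.linear scale scale (\<lambda>y. F (Xs[i := (x, y)]))) \<and>
          (\<forall>x. F (Xs[i := (x, x)]) = 0)"
    using pair_linearD[OF assms, of "take i Xs" "drop (Suc i) Xs"]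
        by (simp add: alternating_bilinear_def)
qed

lemma sg_cochain: "sg n P = ((\<lambda>Xs. sg n (fst P Xs)), (\<lambda>Xs x. sg n (snd P Xs x)))"
  by (auto simp: sg_def prod_eq_iff fun_eq_iff)

context
  fixes scale :: "'k::field \<Rightarrow> 'b::ab_group_add \<Rightarrow> 'b"
  assumes vs: "vector_space scale"
begin

interpretation vector_space scale by (fact vs)

lemma wedge_multilinear_imp_pair_linear:
  assumes "wedge_multilinear scale p F" "\<And>Xs. length Xs \<noteq> p \<Longrightarrow> F Xs = 0"
  shows "pair_linear scale F"
  unfolding pair_linear_def
proof (intro allI)
  fix As Bs
  show "alternating_bilinear scale (\<lambda>Z. F (As @ Z # Bs))"
  proof (cases "length As + length Bs + 1 = p")
    case True
    then show ?thesis
      using assms(1)[unfolded wedge_multilinear_def, rule_format, of "As @ undefined # Bs"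
          "length As"]
      by (simp add: alternating_bilinear_def)
  next
    case False
    then show ?thesis
      using assms(2) vs by (simp add: alternating_bilinear_def Vector_Spaces.linear_iff)
  qed
qed

lemma cochains_iff:
  "P \<in> cochains scale p \<longleftrightarrow> multilinear_cochain scale P \<and>
    (\<forall>Xs. length Xs \<noteq> p \<longrightarrow> fst P Xs = 0 \<and> (\<forall>x. snd P Xs x = 0))"
proof
  assume P: "P \<in> cochains scale p"
  have "pair_linear scale (fst P)"
    by (rule wedge_multilinear_imp_pair_linear[of p]) (use P in \<open>auto simp: cochains_def\<close>)
  moreover have "pair_linear scale (\<lambda>Xs. snd P Xs x)" for x
    by (rule wedge_multilinear_imp_pair_linear[of p]) (use P in \<open>auto simp: cochains_def\<close>)
  moreover have "fst P [] = 0"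
    using P by (cases "p = 0") (auto simp: cochains_def)
  ultimately show "multilinear_cochain scale P \<and>
    (\<forall>Xs. length Xs \<noteq> p \<longrightarrow> fst P Xs = 0 \<and> (\<forall>x. snd P Xs x = 0))"
    using P by (simp add: multilinear_cochain_def cochains_def)
next
  assume P: "multilinear_cochain scale P \<and>
    (\<forall>Xs. length Xs \<noteq> p \<longrightarrow> fst P Xs = 0 \<and> (\<forall>x. snd P Xs x = 0))"
  then show "P \<in> cochains scale p"
    by (auto simp: cochains_def multilinear_cochain_def intro: pair_linear_imp_wedge_multilinear)
qed

lemma cochain_scale_minus_one_power: "cochain_scale scale ((- 1) ^ n) P = sg n P"
  by (simp add: cochain_scale_def sg_cochain scale_minus_one_power)

text \<open>Fixing the last position leaves shuffles of one position less, with \<open>q - 1\<close>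
  pairs in the second block. The \<open>sg p\<close> in \<open>snoc_ins\<close> is the quotient of
  \<open>(-1)^(p * q)\<close> by the \<open>(-1)^(p * (q - 1))\<close> contained in
  \<open>last_ins\<close>.\<close>

lemma snoc_ins_eq_shuffle_sum:
  assumes "length Xs = p + q" "q > 0"
  shows "snoc_ins p q F G Xs = (\<Sum>\<sigma>\<in>{\<sigma> \<in> shuffles_on p (p + q). \<sigma> (p + q - 1) = p + q - 1}.
    scale ((- 1) ^ (p * q) * of_int (sign \<sigma>)) (F (select Xs \<sigma> 0 p) (G (select Xs \<sigma> p (p + q)))))"
proof -
  obtain q' where q: "q = Suc q'" using assms(2) by (cases q) auto
  obtain Ys X where Xs: "Xs = Ys @ [X]" using assms q
      by (metis length_0_conv add_Suc_right nat.distinct(1) rev_exhaust)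
  have len: "length Ys = p + q'" using assms q Xs by simp
  have 1: "select Xs \<sigma> 0 p = select Ys \<sigma> 0 p" "select Xs \<sigma> p (p + q) = select Ys \<sigma> p (p + q') @ [X]"
    if "\<sigma> \<in> shuffles_on p (p + q')" for \<sigma>
  proof -
    have \<sigma>: "\<sigma> permutes {0..<p + q'}" using that by (simp add: shuffles_on_def)
    have "\<sigma> j < length Ys" if "j < p + q'" for j
      using permutes_in_image[OF \<sigma>, of j] that len by simp
    moreover have "\<sigma> (p + q') = p + q'" using permutes_not_in[OF \<sigma>] by simp
    ultimately show "select Xs \<sigma> 0 p = select Ys \<sigma> 0 p" "select Xs \<sigma> p (p + q) =
        select Ys \<sigma> p (p + q') @ [X]"
      by (simp_all add: select_def Xs q nth_append len)
  qed
  have "snoc_ins p q F G Xs =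
      sg (p * q) (shuffle_sum scale p (p + q') (\<lambda>As Bs. F As (G (Bs @ [X]))) Ys)"
    unfolding Xs snoc_ins_snoc[OF assms(2)]
    using last_ins_shuffle_sum[OF len, of F "\<lambda>Bs. G (Bs @ [X])"] q by (simp add: sg_sg)
  also have "\<dots> = (\<Sum>\<sigma>\<in>shuffles_on p (p + q'). scale ((- 1) ^ (p * q) * of_int (sign \<sigma>))
      (F (select Ys \<sigma> 0 p) (G (select Ys \<sigma> p (p + q') @ [X]))))"
    unfolding shuffle_sum_def scale_minus_one_power[symmetric] scale_sum_right scale_scale ..
  also have "\<dots> = (\<Sum>\<sigma>\<in>shuffles_on p (p + q'). scale ((- 1) ^ (p * q) * of_int (sign \<sigma>))
      (F (select Xs \<sigma> 0 p) (G (select Xs \<sigma> p (p + q)))))"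
    using 1 by simp
  finally show ?thesis
    using shuffles_on_fix_last[of q p] q by simp
qed

text \<open>The separate clauses of \<open>circ\<close> for degree 0 are instances of the same
  recursions: for \<open>p = 0\<close> pair insertions vanish by length, and for
  \<open>q = 0\<close> they become the derivation sum. From here on no degree needs special
  treatment.\<close>

lemma circ_eq:
  "circ scale p q P Q =
    ((\<lambda>Xs. if length Xs = p + q then snoc_ins p q (snd P) (fst Q) Xs + pair_ins q (fst P) (snd Q) Xs else 0),
     (\<lambda>Xs x. if length Xs = p + q then full_ins q (snd P) (snd Q) Xs x else 0))"
proof -
  have "circ_I scale p q P Q Xs = snoc_ins p q (snd P) (fst Q) Xs + pair_ins q (fst P) (snd Q) Xs"
    if len: "length Xs = p + q" for Xs
  proof (cases "q = 0")
    case True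
    then show ?thesis using len
        by (auto simp: circ_I_def pair_ins_eq_derivation_sum derivation_sum_def)
  next
    case q: False
    show ?thesis
    proof (cases "p = 0")
      case True
      then have "Xs \<noteq> []" using len q by auto
      then have "snoc_ins p q (snd P) (fst Q) Xs = snd P [] (fst Q Xs)"
        using last_ins_shuffle_sum[of "butlast Xs" 0 "q - 1" "snd P" "\<lambda>Ys. fst Q (Ys @ [last Xs])"]
            True len q
        by (simp add: snoc_ins_def shuffle_sum_0)
      then show ?thesis using True q len by (simp add: circ_I_def pair_ins_short)
    next
      case False
      then show ?thesis
        using q by (simp add: circ_I_def snoc_ins_eq_shuffle_sum[OF len] pair_ins_eq_insertion_sum[OF len])
    qed
  qed
  moreover have "circ_II scale p q P Q Xs x = full_ins q (snd P) (snd Q) Xs x"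
    if len: "length Xs = p + q" for Xs x
  proof (cases "p = 0")
    case True
    then show ?thesis using len
      by (simp add: circ_II_def full_ins_def pair_ins_short last_ins_shuffle_sum[of Xs 0 q] shuffle_sum_0)
  next
    case p: False
    show ?thesis
    proof (cases "q = 0")
      case True
      then show ?thesis using p len
          by (simp add: circ_II_def full_ins_def pair_ins_eq_derivation_sum)
    next
      case False
      have "last_ins q (snd P) (\<lambda>Ys. snd Q Ys x) Xs = (\<Sum>\<sigma> \<in> shuffles_on p (p + q).
          scale ((-1) ^ (p * q) * of_int (sign \<sigma>))
            (snd P (select Xs \<sigma> 0 p) (snd Q (select Xs \<sigma> p (p + q)) x)))"
        unfolding last_ins_shuffle_sum[OF len] shuffle_sum_def scale_minus_one_power[symmetric]
          scale_sum_right scale_scale ..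
      then show ?thesis
        using p False by (simp add: circ_II_def full_ins_def pair_ins_eq_insertion_sum[OF len])
    qed
  qed
  ultimately show ?thesis by (simp add: circ_def fun_eq_iff)
qed

lemma multilinear_cochainD:
  assumes "multilinear_cochain scale P"
  shows "additive (snd P Xs)" "pair_additive (fst P)" "pair_additive (\<lambda>Xs. snd P Xs x)"
  using assms linear_imp_additive pair_linear_imp_additive unfolding multilinear_cochain_def
      by blast+

lemma circ_in_cochains:
  assumes "multilinear_cochain scale P" "multilinear_cochain scale Q"
  shows "circ scale p q P Q \<in> cochains scale (p + q)"
proof -
  have P: "pair_linear scale (fst P)" "\<And>x. pair_linear scale (\<lambda>Xs. snd P Xs x)"
      "\<And>Xs. Vector_Spaces.linear scale scale (snd P Xs)"
   and Q: "pair_linear scale (fst Q)" "\<And>x. pair_linear scale (\<lambda>Xs. snd Q Xs x)"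
       "\<And>Xs. Vector_Spaces.linear scale scale (snd Q Xs)"
    using assms by (auto simp: multilinear_cochain_def)
  have restrict: "pair_linear scale (\<lambda>Xs. if length Xs = n then F Xs else 0)"
      if "pair_linear scale F" for F n
    unfolding pair_linear_def
  proof (intro allI)
    fix As Bs
    show "alternating_bilinear scale (\<lambda>Z. if length (As @ Z # Bs) = n then F (As @ Z # Bs) else 0)"
      using pair_linearD[OF that, of As Bs]
          linear_closed_zero[OF vs linear_closed_alternating[OF vs]]
      by (cases "length As + length Bs + 1 = n") simp_all
  qed
  have 1: "pair_linear scale (\<lambda>Xs. snoc_ins p q (snd P) (fst Q) Xs + pair_ins q (fst P) (snd Q) Xs)"
    by (intro pair_linear_add vs pair_linear_snoc_ins pair_linear_pair_ins P Q)
  have 2: "pair_linear scale (\<lambda>Xs. full_ins q (snd P) (snd Q) Xs x)" for x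
    unfolding full_ins_def
    by (intro pair_linear_add vs pair_linear_last_ins pair_linear_pair_ins P Q)
  have 3: "Vector_Spaces.linear scale scale (full_ins q (snd P) (snd Q) Xs)" for Xs
  proof -
    note lin = linear_closed_linear[OF vs]
    have "Vector_Spaces.linear scale scale (\<lambda>x. last_ins q (snd P) (\<lambda>Ys. snd Q Ys x) Xs)"
      by (rule linear_closed_last_ins_right[OF vs lin P(3), of "\<lambda>x Ys. snd Q Ys x"]) (rule Q(3))
    moreover have "Vector_Spaces.linear scale scale (\<lambda>x. pair_ins q (\<lambda>Ys. snd P Ys x) (snd Q) Xs)"
      by (rule linear_closed_pair_ins_left[OF vs lin, of "\<lambda>x Ys. snd P Ys x"]) (rule P(3))
    ultimately show ?thesis
      using linear_closed_add[OF vs lin] unfolding full_ins_def[abs_def] by blast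
  qed
  have 4: "Vector_Spaces.linear scale scale (\<lambda>x. if length Xs = n
        then full_ins q (snd P) (snd Q) Xs x else 0)" for Xs n
    using 3[of Xs] linear_closed_zero[OF vs linear_closed_linear[OF vs]]
        by (cases "length Xs = n") simp_all
  show ?thesis
    unfolding cochains_iff multilinear_cochain_def circ_eq
    using restrict[OF 1] restrict[OF 2] 4 by auto
qed

lemma additive_circ_left: "additive (\<lambda>P. circ scale p q P Q)"
  by (rule additive.intro) (simp add: circ_eq prod_eq_iff fun_eq_iff plus_fun_def full_ins_def
      pair_ins_add last_ins_add snoc_ins_add add_ac)

lemma additive_circ_right: "multilinear_cochain scale P \<Longrightarrow> additive (\<lambda>Q. circ scale p q P Q)"
  by (rule additive.intro)
    (simp add: circ_eq prod_eq_iff fun_eq_iff plus_fun_def full_ins_def pair_ins_add_right last_ins_add_right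
      snoc_ins_add_right add_ac multilinear_cochainD)

lemma circ_pre_lie:
  assumes "multilinear_cochain scale P" "multilinear_cochain scale Q" "multilinear_cochain scale R"
  shows "circ scale (p + q) r (circ scale p q P Q) R = circ scale p (q + r) P (circ scale q r Q R) +
    sg (q * r) (circ scale (p + r) q (circ scale p r P R) Q - circ scale p (r + q) P (circ scale r q R Q))"
proof (rule prod_eqI; rule ext)
  note P = multilinear_cochainD[OF assms(1)]
  fix Xs
  show "snd (circ scale (p + q) r (circ scale p q P Q) R) Xs =
      snd (circ scale p (q + r) P (circ scale q r Q R) +
    sg (q * r) (circ scale (p + r) q (circ scale p r P R) Q - circ scale p (r + q) P (circ scale r q R Q))) Xs"
  proof (cases "length Xs = p + q + r")
    case len: True
    have left: "full_ins b (\<lambda>Xs x. if length Xs = p + a then full_ins a F G Xs x else 0) H Xs x =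
       full_ins b (full_ins a F G) H Xs x" if "a + b = q + r" for a b F G H x
      unfolding full_ins_def[of b]
      using len that by (intro arg_cong2[of _ _ _ _ "(+)"] last_ins_cong_left[of Xs "p + a"]
          pair_ins_cong_left[of Xs "p + a"]) auto
    have right: "full_ins a F (\<lambda>Xs x. if length Xs = a then full_ins b G H Xs x else 0) Xs x =
       full_ins a F (full_ins b G H) Xs x" for a b F G H x
      unfolding full_ins_def[of a]
      by (intro arg_cong2[of _ _ _ _ "(+)"] last_ins_cong_right pair_ins_cong_right) auto
    show ?thesis
    proof
      fix x
      have "snd (circ scale (p + q) r (circ scale p q P Q) R) Xs x =
          full_ins r (full_ins q (snd P) (snd Q)) (snd R) Xs x"
        "snd (circ scale p (q + r) P (circ scale q r Q R)) Xs x =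
            full_ins (q + r) (snd P) (full_ins r (snd Q) (snd R)) Xs x"
        "snd (circ scale (p + r) q (circ scale p r P R) Q) Xs x =
            full_ins q (full_ins r (snd P) (snd R)) (snd Q) Xs x"
        "snd (circ scale p (r + q) P (circ scale r q R Q)) Xs x =
            full_ins (r + q) (snd P) (full_ins q (snd R) (snd Q)) Xs x"
        using len by (simp_all add: circ_eq left right)
      then show "snd (circ scale (p + q) r (circ scale p q P Q) R) Xs x =
          snd (circ scale p (q + r) P (circ scale q r Q R) +
    sg (q * r) (circ scale (p + r) q (circ scale p r P R) Q - circ scale p (r + q) P
        (circ scale r q R Q))) Xs x"
        using full_ins_full_ins[OF P(1,3), of r q "snd Q" "snd R" Xs x] by (simp add: sg_cochain)
    qed
  next
    case False
    then show ?thesis by (auto simp: circ_eq sg_cochain fun_eq_iff)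
  qed
  show "fst (circ scale (p + q) r (circ scale p q P Q) R) Xs =
      fst (circ scale p (q + r) P (circ scale q r Q R) +
    sg (q * r) (circ scale (p + r) q (circ scale p r P R) Q - circ scale p (r + q) P (circ scale r q R Q))) Xs"
  proof (cases "length Xs = p + q + r")
    case len: True
    have left: "snoc_ins (p + a) b (\<lambda>Xs x. if length Xs = p + a
        then full_ins a F G Xs x else 0) H Xs =
       snoc_ins (p + a) b (full_ins a F G) H Xs"
      "pair_ins b (\<lambda>Xs. if length Xs = p + a then K Xs else 0) J Xs = pair_ins b K J Xs"
        if "a + b = q + r" for a b F G H J K
      using len that by (intro snoc_ins_cong_left pair_ins_cong_left[of Xs "p + a"]; auto)+
    have right: "snoc_ins p a F (\<lambda>Xs. if length Xs = a then K Xs else 0) Xs = snoc_ins p a F K Xs"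
      "pair_ins a L (\<lambda>Xs x. if length Xs = a then full_ins b G H Xs x else 0) Xs =
          pair_ins a L (full_ins b G H) Xs" for a b F G H K L
      by (intro snoc_ins_cong_right pair_ins_cong_right; auto)+
    have outer: "fst (circ scale (p + a) b (circ scale p a P A) B) Xs =
        snoc_ins (p + a) b (full_ins a (snd P) (snd A)) (fst B) Xs +
        (pair_ins b (snoc_ins p a (snd P) (fst A)) (snd B) Xs + pair_ins b
            (pair_ins a (fst P) (snd A)) (snd B) Xs)"
      if "a + b = q + r" for a b A B
      using len that by (simp add: circ_eq left[OF that] pair_ins_add)
    have inner: "fst (circ scale p (a + b) P (circ scale a b A B)) Xs =
        snoc_ins p (a + b) (snd P) (snoc_ins a b (snd A) (fst B)) Xs +
        snoc_ins p (a + b) (snd P) (pair_ins b (fst A) (snd B)) Xs + pair_ins (a + b) (fst P)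
            (full_ins b (snd A) (snd B)) Xs"
      if "a + b = q + r" for a b A B
      using len that by (simp add: circ_eq right snoc_ins_add_right P)
    show ?thesis
      \<comment> \<open>Two instances are needed because each of
        \<open>(P \<circ> Q) \<circ> R\<close> and \<open>(P \<circ> R) \<circ> Q\<close> has a
        \<open>snoc_ins\<close> term matching a \<open>pair_ins\<close> term of the other.
        \<open>pair_ins_pair_ins\<close> handles the terms that start from
        \<open>fst P\<close>.\<close>
      using pair_ins_snoc_ins[of "snd P" r p q "fst Q" "snd R" Xs, OF P(1)]
        pair_ins_snoc_ins[of "snd P" q p r "fst R" "snd Q" Xs, OF P(1)]
        pair_ins_pair_ins[OF P(2), of r q "snd Q" "snd R" Xs]
      by (cases "even q"; cases "even r"; simp add: sg_cochain outer inner; simp add: sg_def)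
  next
    case False
    then show ?thesis by (auto simp: circ_eq sg_cochain)
  qed
qed

end

section \<open>Linearity, grading and the Jacobi identity of the bracket\<close>

lemma bracket_apply:
  "fst (bracket scale P Q) Xs = (\<Sum>p\<le>length Xs. fst (hom_bracket scale p (length Xs - p) P Q) Xs)"
  "snd (bracket scale P Q) Xs x =
      (\<Sum>p\<le>length Xs. snd (hom_bracket scale p (length Xs - p) P Q) Xs x)"
  by (simp_all add: bracket_def)

context
  fixes scale :: "'k::field \<Rightarrow> 'b::ab_group_add \<Rightarrow> 'b"
  assumes vs: "vector_space scale"
begin

interpretation vector_space scale by (fact vs)

lemma hom_bracket_eq: "hom_bracket scale p q P Q =
    circ scale p q P Q - sg (p * q) (circ scale q p Q P)"
  by (simp add: hom_bracket_def cochain_scale_minus_one_power[OF vs])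

lemma circ_linear_left:
  "circ scale p q (P + P') Q = circ scale p q P Q + circ scale p q P' Q"
  "circ scale p q (P - P') Q = circ scale p q P Q - circ scale p q P' Q"
  "circ scale p q (sg n P) Q = sg n (circ scale p q P Q)"
  using additive.add[OF additive_circ_left[OF vs]] additive.diff[OF additive_circ_left[OF vs]]
    additive.minus[OF additive_circ_left[OF vs]] by (simp_all add: sg_def)

lemma circ_linear_right:
  assumes "multilinear_cochain scale P"
  shows "circ scale p q P (Q + Q') = circ scale p q P Q + circ scale p q P Q'"
    "circ scale p q P (Q - Q') = circ scale p q P Q - circ scale p q P Q'"
    "circ scale p q P (sg n Q) = sg n (circ scale p q P Q)"
  using additive.add[OF additive_circ_right[OF vs assms]]
      additive.diff[OF additive_circ_right[OF vs assms]]
    additive.minus[OF additive_circ_right[OF vs assms]] by (simp_all add: sg_def)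

text \<open>Expansion gives twelve triple composites, four for each choice of the outermost left
  factor. Each group of four cancels by one instance of \<open>circ_pre_lie\<close>;
  \<open>comm\<close> aligns the degree arguments, and the parities of the degrees decide the
  signs.\<close>

lemma hom_bracket_jacobi:
  assumes P: "multilinear_cochain scale P" and Q: "multilinear_cochain scale Q"
      and R: "multilinear_cochain scale R"
  shows "hom_bracket scale p (q + r) P (hom_bracket scale q r Q R) =
    hom_bracket scale (p + q) r (hom_bracket scale p q P Q) R +
    sg (p * q) (hom_bracket scale q (p + r) Q (hom_bracket scale p r P R))"
proof -
  have comm: "q + p = p + q" "r + p = p + r" "r + q = q + r"
    by simp_all
  note pre_lie = circ_pre_lie[OF vs P Q R, of p q r] circ_pre_lie[OF vs Q P R, of q p r]
    circ_pre_lie[OF vs R P Q, of r p q]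
  show ?thesis
    unfolding hom_bracket_eq circ_linear_left circ_linear_right[OF P] circ_linear_right[OF Q]
        circ_linear_right[OF R]
    unfolding comm
    by (cases "even p"; cases "even q"; cases "even r"; simp add: sg_def pre_lie[unfolded comm] algebra_simps)
qed

text \<open>A function on \<open>bool\<close> here stands for a pair of values, one of which is to be \<open>c\<close> times the other.\<close>

lemma linear_closed_scale: "linear_closed scale (\<lambda>f. f True = scale c (f False))"
  by (auto simp: linear_closed_def scale_right_distrib Vector_Spaces.linear_iff)

lemma pair_ins_scale_left: "pair_ins q (\<lambda>Ys. scale c (F Ys)) G Xs = scale c (pair_ins q F G Xs)"
  using linear_closed_pair_ins_left[OF vs linear_closed_scale,
      of "\<lambda>z Ys. if z then scale c (F Ys) else F Ys"] by simp

lemma last_ins_scale_left: "last_ins q (\<lambda>Ys x. scale c (F Ys x)) G Xs = scale c (last_ins q F G Xs)"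
  using linear_closed_last_ins_left[OF vs linear_closed_scale,
      of "\<lambda>z Ys x. if z then scale c (F Ys x) else F Ys x"] by simp

lemma pair_ins_scale_right:
  "pair_linear scale F \<Longrightarrow> pair_ins q F (\<lambda>Ys x. scale c (G Ys x)) Xs = scale c (pair_ins q F G Xs)"
  using linear_closed_pair_ins_right[OF vs linear_closed_scale, of F
      "\<lambda>z Ys x. if z then scale c (G Ys x) else G Ys x"] by simp

lemma last_ins_scale_right:
  "(\<And>Ys. Vector_Spaces.linear scale scale (F Ys)) \<Longrightarrow>
    last_ins q F (\<lambda>Ys. scale c (G Ys)) Xs = scale c (last_ins q F G Xs)"
  using linear_closed_last_ins_right[OF vs linear_closed_scale, of F
      "\<lambda>z Ys. if z then scale c (G Ys) else G Ys"] by simp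

lemma sg_scale: "sg n (scale c x) = scale c (sg n x)"
  by (simp add: sg_def)

lemma circ_scale_left: "circ scale p q (cochain_scale scale c P) Q =
    cochain_scale scale c (circ scale p q P Q)"
  by (simp add: circ_eq[OF vs] cochain_scale_def fun_eq_iff full_ins_def snoc_ins_def pair_ins_scale_left
      last_ins_scale_left sg_scale scale_right_distrib)

lemma circ_scale_right:
  assumes "multilinear_cochain scale P"
  shows "circ scale p q P (cochain_scale scale c Q) = cochain_scale scale c (circ scale p q P Q)"
proof -
  have P: "pair_linear scale (fst P)" "\<And>x. pair_linear scale (\<lambda>Xs. snd P Xs x)"
      "\<And>Xs. Vector_Spaces.linear scale scale (snd P Xs)"
    using assms by (auto simp: multilinear_cochain_def)
  show ?thesis
    by (simp add: circ_eq[OF vs] cochain_scale_def fun_eq_iff full_ins_def snoc_ins_def pair_ins_scale_right P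
      last_ins_scale_right sg_scale scale_right_distrib)
qed

lemma vector_space_cochain_scale: "vector_space (cochain_scale scale)"
  by unfold_locales (simp_all add: cochain_scale_def prod_eq_iff fun_eq_iff algebra_simps)

interpretation cochain: vector_space "cochain_scale scale"
  by (fact vector_space_cochain_scale)

lemma sg_cochain_scale: "sg n (cochain_scale scale c P) = cochain_scale scale c (sg n P)"
  by (simp add: sg_def)

lemma hom_bracket_linear:
  assumes P: "multilinear_cochain scale P" and P': "multilinear_cochain scale P'"
      and Q: "multilinear_cochain scale Q"
  shows "hom_bracket scale p q (P + P') Q = hom_bracket scale p q P Q + hom_bracket scale p q P' Q"
    "hom_bracket scale p q Q (P + P') = hom_bracket scale p q Q P + hom_bracket scale p q Q P'"
    "hom_bracket scale p q (cochain_scale scale c P) Q =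
        cochain_scale scale c (hom_bracket scale p q P Q)"
    "hom_bracket scale p q Q (cochain_scale scale c P) =
        cochain_scale scale c (hom_bracket scale p q Q P)"
  unfolding hom_bracket_eq circ_linear_left circ_linear_right[OF P] circ_linear_right[OF P']
      circ_linear_right[OF Q]
    circ_scale_left circ_scale_right[OF Q] sg_cochain_scale cochain.scale_right_diff_distrib
  by (simp_all add: sg_add)

lemma bracket_linear:
  assumes "multilinear_cochain scale P" "multilinear_cochain scale P'" "multilinear_cochain scale Q"
  shows "bracket scale (P + P') Q = bracket scale P Q + bracket scale P' Q"
    "bracket scale Q (P + P') = bracket scale Q P + bracket scale Q P'"
    "bracket scale (cochain_scale scale c P) Q = cochain_scale scale c (bracket scale P Q)"
    "bracket scale Q (cochain_scale scale c P) = cochain_scale scale c (bracket scale Q P)"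
  by (simp_all add: prod_eq_iff fun_eq_iff bracket_apply hom_bracket_linear[OF assms] sum.distrib)
    (simp_all add: cochain_scale_def bracket_apply scale_sum_right)

lemma cochains_multilinear: "P \<in> cochains scale p \<Longrightarrow> multilinear_cochain scale P"
  by (simp add: cochains_iff[OF vs])

lemma subspace_multilinear: "cochain.subspace {P. multilinear_cochain scale P}"
proof (rule cochain.subspaceI)
  note C = linear_closed_zero[OF vs] linear_closed_add[OF vs]
  have lin: "Vector_Spaces.linear scale scale (scale c)" for c
    using vs by (simp add: Vector_Spaces.linear_iff scale_right_distrib mult.commute)
  show "0 \<in> {P. multilinear_cochain scale P}"
    using C[OF linear_closed_alternating[OF vs]] C[OF linear_closed_linear[OF vs]]
    by (simp add: multilinear_cochain_def pair_linear_def zero_fun_def)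
  show "P + Q \<in> {P. multilinear_cochain scale P}"
    if "P \<in> {P. multilinear_cochain scale P}" "Q \<in> {P. multilinear_cochain scale P}" for P Q
    using that C(2)[OF linear_closed_linear[OF vs]]
    by (simp add: multilinear_cochain_def pair_linear_add[OF vs] plus_fun_def)
  show "cochain_scale scale c P \<in> {P. multilinear_cochain scale P}"
    if "P \<in> {P. multilinear_cochain scale P}" for c P
    using that linear_closed_compose[OF vs linear_closed_linear[OF vs] lin]
        linear_closed_compose[OF vs linear_closed_alternating[OF vs] lin]
    by (simp add: multilinear_cochain_def pair_linear_def cochain_scale_def)
qed

lemma subspace_cochains: "cochain.subspace (cochains scale p)"
proof (rule cochain.subspaceI)
  note mult = cochain.subspace_0[OF subspace_multilinear, unfolded mem_Collect_eq]
    cochain.subspace_add[OF subspace_multilinear, unfolded mem_Collect_eq]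
    cochain.subspace_scale[OF subspace_multilinear, unfolded mem_Collect_eq]
  show "0 \<in> cochains scale p" using mult by (simp add: cochains_iff[OF vs])
  show "P + Q \<in> cochains scale p" if "P \<in> cochains scale p" "Q \<in> cochains scale p" for P Q
    using that mult by (simp add: cochains_iff[OF vs])
  show "cochain_scale scale c P \<in> cochains scale p" if "P \<in> cochains scale p" for c P
    using that mult(3) by (simp add: cochains_iff[OF vs]) (simp add: cochain_scale_def)
qed

text \<open>Reduces the axioms quantified over the direct sum to statements about
  \<open>multilinear_cochain\<close>, where \<open>bracket_linear\<close> applies.\<close>

lemma span_cochains_multilinear:
  "P \<in> cochain.span (\<Union>p. cochains scale p) \<Longrightarrow> multilinear_cochain scale P"
  using cochain.span_minimal[OF _ subspace_multilinear, of "\<Union>p. cochains scale p"]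
      cochains_multilinear by blast

lemma cochains_direct:
  assumes "finite I" "\<And>p. p \<in> I \<Longrightarrow> a p \<in> cochains scale p" "(\<Sum>p\<in>I. a p) = 0" "p \<in> I"
  shows "a p = 0"
proof -
  \<comment> \<open>\<open>f\<close> will be evaluation at a list of length \<open>p\<close>, which
    annihilates the components of every other degree.\<close>
  have eq: "f (a p) = 0" if f: "additive f" "\<And>i. i \<in> I - {p} \<Longrightarrow> f (a i) = 0"
      for f :: "'b cochain \<Rightarrow> 'b"
  proof -
    have "0 = (\<Sum>i\<in>I. f (a i))"
      using assms(3) additive.sum[OF f(1), of a I] additive.zero[OF f(1)] by simp
    also have "\<dots> = f (a p)"
      using assms(1,4) f(2) by (simp add: sum.remove)
    finally show ?thesis by simp
  qed
  have "fst (a p) Xs = 0" for Xs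
  proof (cases "length Xs = p")
    case True
    show ?thesis
      by (rule eq[of "\<lambda>P. fst P Xs"])
          (use True assms(2) in \<open>auto simp: additive_def cochains_iff[OF vs]\<close>)
  qed (use assms(2,4) in \<open>auto simp: cochains_iff[OF vs]\<close>)
  moreover have "snd (a p) Xs x = 0" for Xs x
  proof (cases "length Xs = p")
    case True
    show ?thesis
      by (rule eq[of "\<lambda>P. snd P Xs x"])
          (use True assms(2) in \<open>auto simp: additive_def cochains_iff[OF vs]\<close>)
  qed (use assms(2,4) in \<open>auto simp: cochains_iff[OF vs]\<close>)
  ultimately show ?thesis by (simp add: prod_eq_iff fun_eq_iff)
qed

lemma bracket_degree:
  assumes "P \<in> cochains scale p" "Q \<in> cochains scale q"
  shows "bracket scale P Q \<in> cochains scale (p + q)"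
proof -
  have "circ scale p q P Q \<in> cochains scale (p + q)" "circ scale q p Q P \<in> cochains scale (p + q)"
    using circ_in_cochains[OF vs, of P Q p q] circ_in_cochains[OF vs, of Q P q p] assms
        cochains_multilinear
    by (simp_all add: add.commute)
  then show ?thesis
    unfolding bracket_homogeneous[OF vs assms] hom_bracket_def
    by (intro cochain.subspace_diff cochain.subspace_scale subspace_cochains)
qed

lemma bracket_skew:
  assumes "P \<in> cochains scale p" "Q \<in> cochains scale q"
  shows "bracket scale P Q = - cochain_scale scale ((- 1) ^ (p * q)) (bracket scale Q P)"
  unfolding bracket_homogeneous[OF vs assms] bracket_homogeneous[OF vs assms(2,1)]
    cochain_scale_minus_one_power[OF vs] hom_bracket_eq
  by (simp add: sg_def mult.commute)

lemma bracket_jacobi: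
  assumes "P \<in> cochains scale p" "Q \<in> cochains scale q" "R \<in> cochains scale r"
  shows "bracket scale P (bracket scale Q R) = bracket scale (bracket scale P Q) R +
    cochain_scale scale ((- 1) ^ (p * q)) (bracket scale Q (bracket scale P R))"
proof -
  note bh = bracket_homogeneous[OF vs]
  have "bracket scale P (bracket scale Q R) =
      hom_bracket scale p (q + r) P (hom_bracket scale q r Q R)"
    using bh[OF assms(1) bracket_degree[OF assms(2,3)]] bh[OF assms(2,3)] by simp
  moreover have "bracket scale (bracket scale P Q) R =
      hom_bracket scale (p + q) r (hom_bracket scale p q P Q) R"
    using bh[OF bracket_degree[OF assms(1,2)] assms(3)] bh[OF assms(1,2)] by simp
  moreover have "bracket scale Q (bracket scale P R) =
      hom_bracket scale q (p + r) Q (hom_bracket scale p r P R)"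
    using bh[OF assms(2) bracket_degree[OF assms(1,3)]] bh[OF assms(1,3)] by simp
  ultimately show ?thesis
    using hom_bracket_jacobi[OF assms[THEN cochains_multilinear]]
    by (simp add: cochain_scale_minus_one_power[OF vs])
qed

end

section \<open>Lie-Yamaguti structures and the Maurer-Cartan equation\<close>

lemma bracket_self_eq_0:
  assumes "defines_lie_yamaguti scale P"
  shows "bracket scale P P = 0"
proof -
  have P: "P \<in> cochains scale 1" using assms by (simp add: defines_lie_yamaguti_def)
  interpret lie_yamaguti scale "\<lambda>x y. fst P [(x, y)]" "\<lambda>x y z. snd P [(x, y)] z"
    using assms by (simp add: defines_lie_yamaguti_def)
  have vs: "vector_space scale" by (rule vector_space_axioms)
  have "circ scale 1 1 P P = 0"
  proof (rule prod_eqI; rule ext)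
    fix Xs :: "('b \<times> 'b) list"
    consider "length Xs \<noteq> 2" | x y z w where "Xs = [(x, y), (z, w)]"
      by (cases Xs rule: list.exhaust; cases "tl Xs" rule: list.exhaust; cases "tl (tl Xs)"
          rule: list.exhaust) auto
    then have "fst (circ scale 1 1 P P) Xs = 0 \<and> (\<forall>t. snd (circ scale 1 1 P P) Xs t = 0)"
    proof cases
      case 1
      then show ?thesis by (simp add: circ_eq[OF vs])
    next
      case 2
      show ?thesis
        \<comment> \<open>On two pairs the first component of the composite is the defect of
          \<open>LY3\<close> and the second that of \<open>LY4\<close>: the term with the outer
          operation \<open>\<omega> x y\<close> has sign -1, all others have sign 1. In degree 1 the
          bracket of \<open>P\<close> with itself is twice this composite.\<close>
        using LY3[of x y z w] LY4[of x y z w t for t]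
        by (simp add: 2 circ_eq[OF vs] snoc_ins_def full_ins_def sg_def)
    qed
    then show "fst (circ scale 1 1 P P) Xs = fst 0 Xs" "snd (circ scale 1 1 P P) Xs = snd 0 Xs"
      by (simp_all add: fun_eq_iff)
  qed
  then show ?thesis
    by (simp add: bracket_homogeneous[OF vs P P] hom_bracket_eq[OF vs])
qed

theorem theorem3p3:
  fixes scale :: "'k::field_char_0 \<Rightarrow> 'g::ab_group_add \<Rightarrow> 'g"
    and \<pi> :: "'g \<Rightarrow> 'g \<Rightarrow> 'g" and \<omega> :: "'g \<Rightarrow> 'g \<Rightarrow> 'g \<Rightarrow> 'g"
  assumes "lie_yamaguti scale \<pi> \<omega>"
  shows "dg_lie_algebra (cochain_scale scale) (cochains scale) (bracket scale)
           (bracket scale (structure_cochain \<pi> \<omega>)) \<and>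
         (\<forall>\<Pi>'\<in>cochains scale 1.
            defines_lie_yamaguti scale (structure_cochain \<pi> \<omega> + \<Pi>') \<longrightarrow>
            maurer_cartan (cochain_scale scale) (cochains scale) (bracket scale)
              (bracket scale (structure_cochain \<pi> \<omega>)) \<Pi>')"
proof -
  interpret lie_yamaguti scale \<pi> \<omega> by (fact assms)
  have vs: "vector_space scale" by (rule vector_space_axioms)
  interpret cochain: vector_space "cochain_scale scale" by (rule vector_space_cochain_scale[OF vs])
  let ?\<Pi> = "structure_cochain \<pi> \<omega>"
  let ?S = "cochain.span (\<Union>p. cochains scale p)"
  have \<Pi>: "?\<Pi> \<in> cochains scale 1" by (rule structure_cochain_in_cochains[OF assms])
  note ml = cochains_multilinear[OF vs] span_cochains_multilinear[OF vs]
  note lin = bracket_linear[OF vs]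
  note mult = cochain.subspace_0[OF subspace_multilinear[OF vs], unfolded mem_Collect_eq]
    cochain.subspace_add[OF subspace_multilinear[OF vs], unfolded mem_Collect_eq]
    cochain.subspace_scale[OF subspace_multilinear[OF vs], unfolded mem_Collect_eq]
  have sq_\<Pi>: "bracket scale ?\<Pi> ?\<Pi> = 0"
    by (rule bracket_self_eq_0[OF defines_lie_yamaguti_structure_cochain[OF assms]])
  have half: "v = 0" if "v + v = 0" for v :: "'g cochain"
  proof -
    have "cochain_scale scale 2 v = 0"
      using that cochain.scale_left_distrib[of 1 1 v] by simp
    then show ?thesis by simp
  qed
  have sq_hom: "bracket scale ?\<Pi> (bracket scale ?\<Pi> x) = 0" if "x \<in> cochains scale p" for x p
  proof -
    have "bracket scale 0 x = 0"
      using lin(3)[OF ml(1)[OF \<Pi>] ml(1)[OF \<Pi>] ml(1)[OF that], of 0] by simp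
    then have "bracket scale (bracket scale ?\<Pi> ?\<Pi>) x + cochain_scale scale ((- 1) ^ (1 * 1)) v =
        - v" for v
      by (simp add: sq_\<Pi>)
    \<comment> \<open>In the Jacobi identity for two copies of the degree 1 element the sign is -1
      and the first summand is zero, so the double bracket equals its own negative.\<close>
    then have self: "bracket scale ?\<Pi> (bracket scale ?\<Pi> x) =
        - bracket scale ?\<Pi> (bracket scale ?\<Pi> x)"
      by (rule trans[OF bracket_jacobi[OF vs \<Pi> \<Pi> that]])
    show ?thesis
      by (rule half) (rule self[THEN eq_neg_iff_add_eq_0[THEN iffD1]])
  qed
  have sq: "bracket scale ?\<Pi> (bracket scale ?\<Pi> x) = 0" if "x \<in> ?S" for x
  proof -
    \<comment> \<open>Linearity of the bracket is available for multilinear cochains, so the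
      induction over the span carries this property for \<open>x\<close> and for its
      differential.\<close>
    have "multilinear_cochain scale x \<and> multilinear_cochain scale (bracket scale ?\<Pi> x) \<and>
        bracket scale ?\<Pi> (bracket scale ?\<Pi> x) = 0"
      using that
    proof (induction rule: cochain.span_induct_alt)
      case base
      have "bracket scale ?\<Pi> 0 = 0"
        using lin(4)[OF ml(1)[OF \<Pi>] ml(1)[OF \<Pi>] ml(1)[OF \<Pi>], of 0] by simp
      then show ?case using mult(1) by simp
    next
      case (step c x y)
      then obtain p where p: "x \<in> cochains scale p" by blast
      note x = ml(1)[OF p] ml(1)[OF bracket_degree[OF vs \<Pi> p]]
      note y = step(2)[THEN conjunct1] step(2)[THEN conjunct2, THEN conjunct1]
      have eq: "bracket scale ?\<Pi> (cochain_scale scale c u + v) =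
          cochain_scale scale c (bracket scale ?\<Pi> u) + bracket scale ?\<Pi> v"
        if "multilinear_cochain scale u" "multilinear_cochain scale v" for u v
        using lin(2)[OF mult(3)[OF that(1)] that(2) ml(1)[OF \<Pi>]]
            lin(4)[OF that(1) that(1) ml(1)[OF \<Pi>]]
        by simp
      show ?case
        unfolding eq[OF x(1) y(1)] eq[OF x(2) y(2)] sq_hom[OF p]
        using step(2) by (simp add: mult x)
    qed
    then show ?thesis by simp
  qed
  have "dg_lie_algebra (cochain_scale scale) (cochains scale) (bracket scale) (bracket scale ?\<Pi>)"
  proof
    fix x p assume "x \<in> cochains scale p"
    then show "bracket scale ?\<Pi> x \<in> cochains scale (p + 1)"
      using bracket_degree[OF vs \<Pi>] by (metis add.commute)
  next
    fix x y p q assume "x \<in> cochains scale p" "y \<in> cochains scale q"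
    then show "bracket scale ?\<Pi> (bracket scale x y) = bracket scale (bracket scale ?\<Pi> x) y +
        cochain_scale scale ((- 1) ^ p) (bracket scale x (bracket scale ?\<Pi> y))"
      using bracket_jacobi[OF vs \<Pi>, of x p y q] by simp
  next
    show "a p = 0" if "finite I" "\<And>p. p \<in> I \<Longrightarrow> a p \<in> cochains scale p" "(\<Sum>p\<in>I. a p) = 0" "p \<in> I"
        for I a p
      by (rule cochains_direct[OF vs that])
  next
    fix x y z c assume "x \<in> ?S" "y \<in> ?S"
    then have xy: "multilinear_cochain scale x" "multilinear_cochain scale y"
        by (simp_all add: ml(2))
    show "bracket scale (cochain_scale scale c x) y = cochain_scale scale c (bracket scale x y)"
      "bracket scale x (cochain_scale scale c y) = cochain_scale scale c (bracket scale x y)"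
      by (rule lin(3)[OF xy(1,1,2)] lin(4)[OF xy(2,2,1)])+
    show "bracket scale ?\<Pi> (x + y) = bracket scale ?\<Pi> x + bracket scale ?\<Pi> y"
      "bracket scale ?\<Pi> (cochain_scale scale c x) = cochain_scale scale c (bracket scale ?\<Pi> x)"
      by (rule lin(2)[OF xy ml(1)[OF \<Pi>]] lin(4)[OF xy ml(1)[OF \<Pi>]])+
    assume "z \<in> ?S"
    then have z: "multilinear_cochain scale z" by (rule ml(2))
    show "bracket scale (x + y) z = bracket scale x z + bracket scale y z"
      by (rule lin(1)[OF xy z])
    show "bracket scale x (y + z) = bracket scale x y + bracket scale x z"
      by (rule lin(2)[OF xy(2) z xy(1)])
  qed (rule subspace_cochains[OF vs] bracket_degree[OF vs] bracket_skew[OF vs] bracket_jacobi[OF vs]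
      sq; assumption)+
  moreover have "maurer_cartan (cochain_scale scale) (cochains scale) (bracket scale) (bracket scale ?\<Pi>) \<Pi>'"
    if \<Pi>': "\<Pi>' \<in> cochains scale 1" and LY: "defines_lie_yamaguti scale (?\<Pi> + \<Pi>')" for \<Pi>'
  proof -
    note m = ml(1)[OF \<Pi>] ml(1)[OF \<Pi>']
    have m': "multilinear_cochain scale (?\<Pi> + \<Pi>')"
      by (rule mult(2)[OF m])
    have "0 = bracket scale (?\<Pi> + \<Pi>') (?\<Pi> + \<Pi>')"
      using bracket_self_eq_0[OF LY] by simp
    also have "\<dots> = bracket scale ?\<Pi> ?\<Pi> + bracket scale \<Pi>' ?\<Pi> +
        (bracket scale ?\<Pi> \<Pi>' + bracket scale \<Pi>' \<Pi>')"
      unfolding lin(2)[OF m m'] lin(1)[OF m m(1)] lin(1)[OF m m(2)] ..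
    also have "bracket scale ?\<Pi> ?\<Pi> = 0"
      by (rule sq_\<Pi>)
    \<comment> \<open>In degree 1 graded skew-symmetry is symmetry. The cross terms add up to twice
      the differential of \<open>\<Pi>'\<close>, and multiplying by 1/2 gives the stated
      equation.\<close>
    also have "bracket scale \<Pi>' ?\<Pi> = bracket scale ?\<Pi> \<Pi>'"
      using bracket_skew[OF vs \<Pi>' \<Pi>] by simp
    finally have "cochain_scale scale (1 / 2) (bracket scale ?\<Pi> \<Pi>' + bracket scale ?\<Pi> \<Pi>' +
        bracket scale \<Pi>' \<Pi>') = 0"
      by (simp add: add_ac)
    moreover have "cochain_scale scale (1 / 2) v + cochain_scale scale (1 / 2) v = v" for v
      by (simp flip: cochain.scale_left_distrib)
    ultimately show ?thesis
      using \<Pi>' by (simp add: maurer_cartan_def cochain.scale_right_distrib)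
  qed
  ultimately show ?thesis by blast
qed

end
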